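(* Let $X$ be a compact complex manifold of complex dimension $n$. Then for all $p,q$, $$g^{p,q}_{\partial}=g^{p+1,q-1}_{\bar\partial}.$$
   Context: On smooth complex-valued $(p,q)$-forms on $X$, define $H^{p,q}_A=\ker(\partial\bar\partial)/(\operatorname{im}(\partial)+\operatorname{im}(\bar\partial))$, $H^{p,q}_{\bar\partial}=\ker(\bar\partial)/\operatorname{im}(\bar\partial)$, $H^{p,q}_{\partial}=\ker(\partial)/\operatorname{im}(\partial)$ (all spaces in bidegree $(p,q)$; spaces outside the range $0\le p,q\le n$ are zero). Consider the maps $\partial:H^{p,q}_A\to H^{p+1,q}_{\bar\partial}$, $[\theta]_A\mapsto[\partial\theta]_{\bar\partial}$, and $\bar\partial:H^{p,q}_A\to H^{p,q+1}_{\partial}$, $[\theta]_A\mapsto[\bar\partial\theta]_{\partial}$, and the natural maps $\pi_A:H^{p,q}_{\partial}\to H^{p,q}_A$ and $\pi_A:H^{p,q}_{\bar\partial}\to H^{p,q}_A$ induced by the identity on forms. Set $$\mathcal G^{p,q}_{\partial}=\ker(\partial:H^{p,q}_A\to H^{p+1,q}_{\bar\partial}),\qquad G^{p,q}_{\partial}=\mathcal G^{p,q}_{\partial}/\operatorname{im}(\pi_A:H^{p,q}_{\partial}\to H^{p,q}_A),$$ $$\mathcal G^{p,q}_{\bar\partial}=\ker(\bar\partial:H^{p,q}_A\to H^{p,q+1}_{\partial}),\qquad G^{p,q}_{\bar\partial}=\mathcal G^{p,q}_{\bar\partial}/\operatorname{im}(\pi_A:H^{p,q}_{\bar\partial}\to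 H^{p,q}_A),$$ and $g^{p,q}_{\partial}=\dim_{\mathbb C}G^{p,q}_{\partial}$, $g^{p,q}_{\bar\partial}=\dim_{\mathbb C}G^{p,q}_{\bar\partial}$. *)

theory Defs
  imports "HOL-Analysis.Analysis" "HOL-Algebra.AbelCoset" "Jordan_Normal_Form.Missing_VectorSpace"
begin

section \<open>Smooth functions and Wirtinger derivatives on open subsets of \<open>\<complex>\<^sup>n\<close>\<close>

fun Ck_on :: "nat \<Rightarrow> 'e::real_normed_vector set \<Rightarrow> ('e \<Rightarrow> 'f::real_normed_vector) \<Rightarrow> bool" where
  "Ck_on 0 S f \<longleftrightarrow> continuous_on S f"
| "Ck_on (Suc k) S f \<longleftrightarrow> (\<forall>x\<in>S. f differentiable (at x)) \<and>
     (\<forall>v. Ck_on k S (\<lambda>x. frechet_derivative f (at x) v))"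

definition smooth_on :: "'e::real_normed_vector set \<Rightarrow> ('e \<Rightarrow> 'f::real_normed_vector) \<Rightarrow> bool" where
  "smooth_on S f \<longleftrightarrow> (\<forall>k. Ck_on k S f)"

text \<open>With \<open>z\<^sub>k = x\<^sub>k + \<i> y\<^sub>k\<close>, the vectors \<^term>\<open>axis k 1\<close> and \<^term>\<open>axis k \<i>\<close> are the directions
  of \<open>x\<^sub>k\<close> and \<open>y\<^sub>k\<close>.\<close>

definition d_dz :: "'n::finite \<Rightarrow> (complex^'n \<Rightarrow> complex) \<Rightarrow> complex^'n \<Rightarrow> complex" where
  "d_dz k f z = (frechet_derivative f (at z) (axis k 1) - \<i> * frechet_derivative f (at z) (axis k \<i>)) / 2"

definition d_dzbar :: "'n::finite \<Rightarrow> (complex^'n \<Rightarrow> complex) \<Rightarrow> complex^'n \<Rightarrow> complex" where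
  "d_dzbar k f z = (frechet_derivative f (at z) (axis k 1) + \<i> * frechet_derivative f (at z) (axis k \<i>)) / 2"

text \<open>A map is holomorphic if its components are smooth solutions of the Cauchy-Riemann equations.\<close>

definition holomorphic_map_on :: "(complex^'n::finite) set \<Rightarrow> (complex^'n \<Rightarrow> complex^'m::finite) \<Rightarrow> bool" where
  "holomorphic_map_on S f \<longleftrightarrow>
     (\<forall>i. smooth_on S (\<lambda>z. f z $ i)) \<and> (\<forall>z\<in>S. \<forall>i k. d_dzbar k (\<lambda>z. f z $ i) z = 0)"


section \<open>Complex manifolds\<close>

text \<open>A chart is a pair \<open>(U, \<phi>)\<close>; only the values of \<open>\<phi>\<close> on \<open>U\<close> matter.\<close>

type_synonym ('a, 'n) chart = "'a set \<times> ('a \<Rightarrow> complex^'n)"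

definition chart_image :: "('a, 'n::finite) chart \<Rightarrow> (complex^'n) set" where
  "chart_image c = snd c ` fst c"

definition transition :: "('a, 'n::finite) chart \<Rightarrow> ('a, 'n) chart \<Rightarrow> complex^'n \<Rightarrow> complex^'n" where
  "transition c c' = snd c' \<circ> inv_into (fst c) (snd c)"

definition transition_domain :: "('a, 'n::finite) chart \<Rightarrow> ('a, 'n) chart \<Rightarrow> (complex^'n) set" where
  "transition_domain c c' = snd c ` (fst c \<inter> fst c')"

text \<open>The complex dimension is \<^term>\<open>CARD('n)\<close>. The manifold need not be connected.\<close>

definition complex_manifold :: "'a topology \<Rightarrow> ('a, 'n::finite) chart set \<Rightarrow> bool" where
  "complex_manifold X \<A> \<longleftrightarrow>
     Hausdorff_space X \<and> second_countable X \<and>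
     (\<Union>c\<in>\<A>. fst c) = topspace X \<and>
     (\<forall>c\<in>\<A>. openin X (fst c) \<and> open (chart_image c) \<and>
        homeomorphic_map (subtopology X (fst c)) (top_of_set (chart_image c)) (snd c)) \<and>
     (\<forall>c\<in>\<A>. \<forall>c'\<in>\<A>. holomorphic_map_on (transition_domain c c') (transition c c'))"


section \<open>Exterior algebra\<close>

text \<open>A complex-valued \<open>k\<close>-covector on \<open>\<complex>\<^sup>n\<close> is a function on lists of tangent vectors that vanishes
  on lists of length other than \<open>k\<close>. The wedge product of a 1-covector with a \<open>k\<close>-covector is
  normalised so that \<open>(\<beta>\<^sub>1 \<and> \<dots> \<and> \<beta>\<^sub>k)(v\<^sub>1, \<dots>, v\<^sub>k) = det (\<beta>\<^sub>i(v\<^sub>j))\<close>.\<close>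

type_synonym 'n covector = "(complex^'n) list \<Rightarrow> complex"

definition wedge1 :: "('v \<Rightarrow> complex) \<Rightarrow> ('v list \<Rightarrow> complex) \<Rightarrow> 'v list \<Rightarrow> complex" where
  "wedge1 \<beta> \<alpha> vs = (\<Sum>i<length vs. (-1) ^ i * \<beta> (vs ! i) * \<alpha> (take i vs @ drop (Suc i) vs))"

fun wedge :: "('v \<Rightarrow> complex) list \<Rightarrow> 'v list \<Rightarrow> complex" where
  "wedge [] = (\<lambda>vs. if vs = [] then 1 else 0)"
| "wedge (\<beta> # \<beta>s) = wedge1 \<beta> (wedge \<beta>s)"

definition dz :: "'n::finite \<Rightarrow> complex^'n \<Rightarrow> complex" where
  "dz k v = v $ k"

definition dzbar :: "'n::finite \<Rightarrow> complex^'n \<Rightarrow> complex" where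
  "dzbar k v = cnj (v $ k)"


section \<open>Smooth \<open>(p,q)\<close>-forms on open subsets of \<open>\<complex>\<^sup>n\<close>\<close>

text \<open>\<open>\<omega> = \<Sum> a\<^sub>I\<^sub>J dz\<^sub>I \<and> dzbar\<^sub>J\<close> with smooth coefficients. The sum runs over all, not only the
  increasing, multi-indices \<open>I\<close> and \<open>J\<close> of length \<open>p\<close> and \<open>q\<close>, so the coefficients are not
  unique, but the resulting forms are the same.\<close>

definition local_pq_form ::
    "(complex^'n::finite) set \<Rightarrow> nat \<Rightarrow> nat \<Rightarrow> (complex^'n \<Rightarrow> 'n covector) \<Rightarrow> bool" where
  "local_pq_form S p q \<omega> \<longleftrightarrow> (\<exists>a :: 'n list \<Rightarrow> 'n list \<Rightarrow> complex^'n \<Rightarrow> complex.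
     (\<forall>I J. smooth_on S (a I J)) \<and>
     (\<forall>z\<in>S. \<forall>vs. \<omega> z vs =
        (\<Sum>I | length I = p. \<Sum>J | length J = q. a I J z * wedge (map dz I @ map dzbar J) vs)))"

text \<open>\<open>\<partial>\<omega> = \<Sum>\<^sub>k dz\<^sub>k \<and> \<partial>\<omega>/\<partial>z\<^sub>k\<close>, where \<open>\<partial>/\<partial>z\<^sub>k\<close> acts on the coefficients with respect to the
  constant covectors; similarly for the conjugate operator.\<close>

definition local_del :: "(complex^'n::finite \<Rightarrow> 'n covector) \<Rightarrow> complex^'n \<Rightarrow> 'n covector" where
  "local_del \<omega> z vs = (\<Sum>k\<in>UNIV. wedge1 (dz k) (\<lambda>us. d_dz k (\<lambda>w. \<omega> w us) z) vs)"

definition local_delbar :: "(complex^'n::finite \<Rightarrow> 'n covector) \<Rightarrow> complex^'n \<Rightarrow> 'n covector" where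
  "local_delbar \<omega> z vs = (\<Sum>k\<in>UNIV. wedge1 (dzbar k) (\<lambda>us. d_dzbar k (\<lambda>w. \<omega> w us) z) vs)"


section \<open>Smooth \<open>(p,q)\<close>-forms on a complex manifold\<close>

text \<open>A form on the manifold is the family of its coordinate expressions in the charts of the atlas,
  which are related by pullback along the transition maps. Coordinate expressions are zero by
  convention outside the image of the chart, and for pairs that are not charts of the atlas.\<close>

type_synonym ('a, 'n) mform = "('a, 'n) chart \<Rightarrow> complex^'n \<Rightarrow> 'n covector"

definition pq_forms :: "('a, 'n::finite) chart set \<Rightarrow> int \<Rightarrow> int \<Rightarrow> ('a, 'n) mform set" where
  "pq_forms \<A> p q = (if p < 0 \<or> q < 0 then {\<lambda>_ _ _. 0} else
     {\<omega>. (\<forall>c\<in>\<A>. local_pq_form (chart_image c) (nat p) (nat q) (\<omega> c)) \<and>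
          (\<forall>c\<in>\<A>. \<forall>c'\<in>\<A>. \<forall>z\<in>transition_domain c c'. \<forall>vs.
             \<omega> c z vs = \<omega> c' (transition c c' z) (map (frechet_derivative (transition c c') (at z)) vs)) \<and>
          (\<forall>c z vs. c \<notin> \<A> \<or> z \<notin> chart_image c \<longrightarrow> \<omega> c z vs = 0)})"

definition del :: "('a, 'n::finite) chart set \<Rightarrow> ('a, 'n) mform \<Rightarrow> ('a, 'n) mform" where
  "del \<A> \<omega> c z vs = (if c \<in> \<A> \<and> z \<in> chart_image c then local_del (\<omega> c) z vs else 0)"

definition delbar :: "('a, 'n::finite) chart set \<Rightarrow> ('a, 'n) mform \<Rightarrow> ('a, 'n) mform" where
  "delbar \<A> \<omega> c z vs = (if c \<in> \<A> \<and> z \<in> chart_image c then local_delbar (\<omega> c) z vs else 0)"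

text \<open>For \<open>p > n\<close> or \<open>q > n\<close> the space of forms is zero because \<open>dz\<^sub>I \<and> dzbar\<^sub>J\<close> then has a
  repeated factor.\<close>

lemma wedge1_Nil [simp]: "wedge1 \<beta> \<alpha> [] = 0"
  by (simp add: wedge1_def)

lemma wedge1_Cons [simp]: "wedge1 \<beta> \<alpha> (v # vs) = \<beta> v * \<alpha> vs - wedge1 \<beta> (\<lambda>us. \<alpha> (v # us)) vs"
  by (simp add: wedge1_def sum.lessThan_Suc_shift sum_negf [symmetric] del: sum.lessThan_Suc)

lemma wedge1_diff: "wedge1 \<beta> (\<lambda>us. f us - g us) vs = wedge1 \<beta> f vs - wedge1 \<beta> g vs"
  by (simp add: wedge1_def right_diff_distrib sum_subtractf)

lemma wedge1_scale: "wedge1 \<beta> (\<lambda>us. c * f us) vs = c * wedge1 \<beta> f vs"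
  by (simp add: wedge1_def sum_distrib_left mult_ac)

lemma wedge1_anticommute: "wedge1 \<beta> (wedge1 \<gamma> \<alpha>) vs = - wedge1 \<gamma> (wedge1 \<beta> \<alpha>) vs"
  by (induction vs arbitrary: \<alpha>) (simp_all add: wedge1_diff wedge1_scale)

lemma wedge_repeated:
  assumes "\<beta> \<in> set \<beta>s"
  shows "wedge1 \<beta> (wedge \<beta>s) vs = 0"
  using assms
proof (induction \<beta>s arbitrary: vs)
  case (Cons \<gamma> \<beta>s)
  show ?case
  proof (cases "\<gamma> = \<beta>")
    case True
    then show ?thesis
      using wedge1_anticommute [of \<beta> \<beta> "wedge \<beta>s" vs] by simp
  next
    case False
    then have "wedge1 \<beta> (wedge \<beta>s) = (\<lambda>_. 0)"
      using Cons by auto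
    moreover have "wedge1 \<beta> (wedge1 \<gamma> (wedge \<beta>s)) vs = - wedge1 \<gamma> (wedge1 \<beta> (wedge \<beta>s)) vs"
      by (rule wedge1_anticommute)
    ultimately show ?thesis
      by (simp add: wedge1_def)
  qed
qed simp

lemma wedge_not_distinct: "\<not> distinct \<beta>s \<Longrightarrow> wedge \<beta>s vs = 0"
proof (induction \<beta>s arbitrary: vs)
  case (Cons \<beta> \<beta>s)
  show ?case
  proof (cases "\<beta> \<in> set \<beta>s")
    case False
    then have "wedge \<beta>s = (\<lambda>_. 0)"
      using Cons by auto
    then show ?thesis
      by (simp add: wedge1_def)
  qed (simp add: wedge_repeated)
qed simp

lemma smooth_on_zero: "smooth_on S (\<lambda>_. 0 :: 'f::real_normed_vector)"
proof -
  have "Ck_on k S (\<lambda>_. 0 :: 'f)" for k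
    by (induction k) (simp_all add: frechet_derivative_const)
  then show ?thesis
    by (simp add: smooth_on_def)
qed

lemma length_gt_card_not_distinct:
  fixes I :: "'n::finite list"
  assumes "length I > CARD('n)"
  shows "\<not> distinct I"
proof
  assume "distinct I"
  then have "length I = card (set I)"
    by (simp add: distinct_card)
  also have "\<dots> \<le> CARD('n)"
    by (intro card_mono) auto
  finally show False
    using assms by simp
qed

lemma pq_forms_outside:
  fixes \<A> :: "('a, 'n::finite) chart set"
  assumes "\<not> (0 \<le> p \<and> p \<le> int CARD('n) \<and> 0 \<le> q \<and> q \<le> int CARD('n))"
  shows "pq_forms \<A> p q = {\<lambda>_ _ _. 0}"
proof (cases "p < 0 \<or> q < 0")
  case True
  then show ?thesis
    by (simp add: pq_forms_def)
next
  case False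
  then have big: "nat p > CARD('n) \<or> nat q > CARD('n)"
    using assms by auto
  have wedge0: "wedge (map dz I @ map dzbar J) vs = 0"
    if "length I = nat p" "length J = nat q" for I J :: "'n list" and vs
    using big that length_gt_card_not_distinct [of I] length_gt_card_not_distinct [of J]
    by (intro wedge_not_distinct) (auto simp: distinct_map)
  have local: "(\<forall>z\<in>S. \<forall>vs. \<omega> z vs = 0) \<longleftrightarrow> local_pq_form S (nat p) (nat q) \<omega>"
    for S and \<omega> :: "complex^'n \<Rightarrow> 'n covector"
    using smooth_on_zero [of S] wedge0
    by (auto simp: local_pq_form_def intro!: exI [of _ "\<lambda>_ _ _. 0"])
  have "\<omega> \<in> pq_forms \<A> p q \<longleftrightarrow> \<omega> = (\<lambda>_ _ _. 0)" for \<omega> :: "('a, 'n) mform"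
  proof
    assume "\<omega> \<in> pq_forms \<A> p q"
    then have "\<omega> c z vs = 0" for c z vs
      using False by (cases "c \<in> \<A> \<and> z \<in> chart_image c")
        (auto simp: pq_forms_def local [symmetric] simp del: split_paired_All)
    then show "\<omega> = (\<lambda>_ _ _. 0)"
      by (intro ext)
  qed (use False in \<open>simp add: pq_forms_def local [symmetric]\<close>)
  then show ?thesis
    by blast
qed


section \<open>Complex vector spaces and quotients\<close>

definition complex_field :: "complex ring" where
  "complex_field = \<lparr>carrier = UNIV, mult = (*), one = 1, zero = 0, add = (+)\<rparr>"

definition quotient_module :: "('k, 'v) module \<Rightarrow> 'v set \<Rightarrow> ('k, 'v set) module" where
  "quotient_module M N = \<lparr>carrier = a_rcosets\<^bsub>M\<^esub> N, mult = undefined, one = undefined,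
     zero = N, add = set_add M, smult = (\<lambda>c C. \<Union>x\<in>C. N +>\<^bsub>M\<^esub> (c \<odot>\<^bsub>M\<^esub> x))\<rparr>"

text \<open>The map on cosets \<open>[x] \<mapsto> [f x]\<close> with values in the quotient of \<open>M\<close> by \<open>N\<close>.\<close>

definition induced_map :: "('k, 'v) module \<Rightarrow> 'v set \<Rightarrow> ('u \<Rightarrow> 'v) \<Rightarrow> 'u set \<Rightarrow> 'v set" where
  "induced_map M N f C = (\<Union>x\<in>C. N +>\<^bsub>M\<^esub> f x)"


section \<open>Aeppli and Dolbeault cohomology\<close>

definition form_space :: "('a, 'n::finite) chart set \<Rightarrow> int \<Rightarrow> int \<Rightarrow> (complex, ('a, 'n) mform) module" where
  "form_space \<A> p q = \<lparr>carrier = pq_forms \<A> p q, mult = undefined, one = undefined,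
     zero = (\<lambda>_ _ _. 0), add = (\<lambda>\<omega> \<eta> c z vs. \<omega> c z vs + \<eta> c z vs),
     smult = (\<lambda>a \<omega> c z vs. a * \<omega> c z vs)\<rparr>"

definition im_del :: "('a, 'n::finite) chart set \<Rightarrow> int \<Rightarrow> int \<Rightarrow> ('a, 'n) mform set" where
  "im_del \<A> p q = del \<A> ` pq_forms \<A> (p - 1) q"

definition im_delbar :: "('a, 'n::finite) chart set \<Rightarrow> int \<Rightarrow> int \<Rightarrow> ('a, 'n) mform set" where
  "im_delbar \<A> p q = delbar \<A> ` pq_forms \<A> p (q - 1)"

definition im_A :: "('a, 'n::finite) chart set \<Rightarrow> int \<Rightarrow> int \<Rightarrow> ('a, 'n) mform set" where
  "im_A \<A> p q = im_del \<A> p q <+>\<^bsub>form_space \<A> p q\<^esub> im_delbar \<A> p q"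

definition H_A :: "('a, 'n::finite) chart set \<Rightarrow> int \<Rightarrow> int \<Rightarrow> (complex, ('a, 'n) mform set) module" where
  "H_A \<A> p q = quotient_module
     (form_space \<A> p q \<lparr>carrier := {\<theta> \<in> pq_forms \<A> p q. del \<A> (delbar \<A> \<theta>) = (\<lambda>_ _ _. 0)}\<rparr>)
     (im_A \<A> p q)"

definition H_delbar :: "('a, 'n::finite) chart set \<Rightarrow> int \<Rightarrow> int \<Rightarrow> (complex, ('a, 'n) mform set) module" where
  "H_delbar \<A> p q = quotient_module
     (form_space \<A> p q \<lparr>carrier := {\<theta> \<in> pq_forms \<A> p q. delbar \<A> \<theta> = (\<lambda>_ _ _. 0)}\<rparr>)
     (im_delbar \<A> p q)"

definition H_del :: "('a, 'n::finite) chart set \<Rightarrow> int \<Rightarrow> int \<Rightarrow> (complex, ('a, 'n) mform set) module" where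
  "H_del \<A> p q = quotient_module
     (form_space \<A> p q \<lparr>carrier := {\<theta> \<in> pq_forms \<A> p q. del \<A> \<theta> = (\<lambda>_ _ _. 0)}\<rparr>)
     (im_del \<A> p q)"

text \<open>\<open>pi_A\<close> serves for both natural maps, from \<^const>\<open>H_del\<close> and from \<^const>\<open>H_delbar\<close>.\<close>

definition del_A :: "('a, 'n::finite) chart set \<Rightarrow> int \<Rightarrow> int \<Rightarrow> ('a, 'n) mform set \<Rightarrow> ('a, 'n) mform set" where
  "del_A \<A> p q = induced_map (form_space \<A> (p + 1) q) (im_delbar \<A> (p + 1) q) (del \<A>)"

definition delbar_A :: "('a, 'n::finite) chart set \<Rightarrow> int \<Rightarrow> int \<Rightarrow> ('a, 'n) mform set \<Rightarrow> ('a, 'n) mform set" where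
  "delbar_A \<A> p q = induced_map (form_space \<A> p (q + 1)) (im_del \<A> p (q + 1)) (delbar \<A>)"

definition pi_A :: "('a, 'n::finite) chart set \<Rightarrow> int \<Rightarrow> int \<Rightarrow> ('a, 'n) mform set \<Rightarrow> ('a, 'n) mform set" where
  "pi_A \<A> p q = induced_map (form_space \<A> p q) (im_A \<A> p q) (\<lambda>\<theta>. \<theta>)"

definition calG_del :: "('a, 'n::finite) chart set \<Rightarrow> int \<Rightarrow> int \<Rightarrow> ('a, 'n) mform set set" where
  "calG_del \<A> p q = a_kernel (H_A \<A> p q) (H_delbar \<A> (p + 1) q) (del_A \<A> p q)"

definition calG_delbar :: "('a, 'n::finite) chart set \<Rightarrow> int \<Rightarrow> int \<Rightarrow> ('a, 'n) mform set set" where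
  "calG_delbar \<A> p q = a_kernel (H_A \<A> p q) (H_del \<A> p (q + 1)) (delbar_A \<A> p q)"

definition G_del :: "('a, 'n::finite) chart set \<Rightarrow> int \<Rightarrow> int \<Rightarrow> (complex, ('a, 'n) mform set set) module" where
  "G_del \<A> p q = quotient_module (H_A \<A> p q \<lparr>carrier := calG_del \<A> p q\<rparr>)
     (pi_A \<A> p q ` carrier (H_del \<A> p q))"

definition G_delbar :: "('a, 'n::finite) chart set \<Rightarrow> int \<Rightarrow> int \<Rightarrow> (complex, ('a, 'n) mform set set) module" where
  "G_delbar \<A> p q = quotient_module (H_A \<A> p q \<lparr>carrier := calG_delbar \<A> p q\<rparr>)
     (pi_A \<A> p q ` carrier (H_delbar \<A> p q))"

definition g_del :: "('a, 'n::finite) chart set \<Rightarrow> int \<Rightarrow> int \<Rightarrow> nat" where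
  "g_del \<A> p q = vectorspace.dim complex_field (G_del \<A> p q)"

definition g_delbar :: "('a, 'n::finite) chart set \<Rightarrow> int \<Rightarrow> int \<Rightarrow> nat" where
  "g_delbar \<A> p q = vectorspace.dim complex_field (G_delbar \<A> p q)"

end

theory Submission
  imports Defs
begin

text \<open>The class of \<open>\<theta>\<close> lies in \<open>\<G>\<^sub>\<partial>\<close> iff \<open>\<partial>\<theta>\<close> is \<open>\<partial>bar\<close>-exact, so \<open>\<theta> \<mapsto> \<partial>\<theta>\<close> induces an isomorphism
  of \<open>G\<^sub>\<partial>\<close> in bidegree \<open>(p,q)\<close> onto \<open>(im \<partial> \<inter> im \<partial>bar) / im \<partial>\<partial>bar\<close> in bidegree \<open>(p+1,q)\<close>. By the symmetric
  argument \<open>\<partial>bar\<close> induces an isomorphism of the conjugate space in bidegree \<open>(p+1,q-1)\<close> onto the same quotient.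

  This uses only that the forms are a double complex. The analytic input is the symmetry of
  second derivatives, which makes \<open>\<partial>\<close> and \<open>\<partial>bar\<close> square to zero and anticommute, and the naturality
  of both operators under holomorphic maps \<open>T\<close>, which holds because the pullbacks of \<open>dz\<^sub>i\<close> and
  \<open>dzbar\<^sub>i\<close> along \<open>T\<close> are closed for each of the two operators.\<close>

section \<open>Quotients of vector spaces\<close>

text \<open>Surjectivity onto im \<partial> \<inter> im \<partial>bar holds because a form whose
  \<partial> is \<partial>bar-exact is automatically \<partial>\<partial>bar-closed and so has an
  Aeppli class. The denominator im \<partial>\<partial>bar arises because \<partial> sees only the
  \<partial>bar-part of an element of im \<partial> + im \<partial>bar. The two sides of the theorem
  then differ by a sign, which the image of a subspace absorbs.

  \<open>dim\<close> is a \<open>LEAST\<close> over sizes of finite generating sets, so an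
  isomorphism has to be shown to preserve the whole predicate. The definitions build cosets of
  cosets over records with varying carriers; all of them are cut out of one ambient space.

  Coordinate sums are awkward to compare across charts. Both operators are therefore rewritten as
  one coordinate-free operator with a complex parameter \<epsilon>, and the analytic facts are
  proved once for arbitrary \<epsilon>. Naturality comes down to the differential of a holomorphic
  map commuting with multiplication by \<open>\<i>\<close>.\<close>

lemma (in linear_map) span_image:
  assumes "inj_on T (carrier V)" "finite A" "A \<subseteq> carrier V"
  shows "W.module.span (T ` A) = T ` V.module.span A"
proof -
  have TA: "finite (T ` A)" "T ` A \<subseteq> carrier W"
    using assms by auto
  \<comment> \<open>Coefficients on \<open>A\<close> are carried to the image by
    \<open>inv_into A T\<close>; injectivity of \<open>T\<close> prevents two vectors of
    \<open>A\<close> from being merged.\<close>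
  have coeff: "\<exists>b. b \<in> T ` A \<rightarrow> carrier K \<and> V.module.lincomb a A = V.module.lincomb (b \<circ> T) A" if "a \<in> A \<rightarrow> carrier K" for a
  proof (intro exI conjI)
    have inv: "inv_into A T (T x) = x" if "x \<in> A" for x
      using that assms by (meson inj_on_subset inv_into_f_f)
    show "a \<circ> inv_into A T \<in> T ` A \<rightarrow> carrier K"
      using that inv by auto
    show "V.module.lincomb a A = V.module.lincomb ((a \<circ> inv_into A T) \<circ> T) A"
      using that inv assms(3) by (intro V.module.lincomb_cong) auto
  qed
  have lin: "W.module.lincomb b (T ` A) = T (V.module.lincomb (b \<circ> T) A)" if "b \<in> T ` A \<rightarrow> carrier K" for b
    using lincomb_linear_image [OF assms(1,3) that assms(2)] .
  have "b \<circ> T \<in> A \<rightarrow> carrier K" if "b \<in> T ` A \<rightarrow> carrier K" for b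
    using that by auto
  then show ?thesis
    unfolding W.module.finite_span [OF TA] V.module.finite_span [OF assms(2,3)]
    apply (intro equalityI subsetI)
    subgoal using lin by blast
    subgoal for w using lin coeff by (smt (verit, ccfv_threshold) imageE mem_Collect_eq)
    done
qed

text \<open>A linear bijection matches generating sets of each size \<open>n\<close> in both
  directions. Hence the predicates under the two \<open>LEAST\<close> operators are equal, and so
  are the dimensions, even when no finite generating set exists.\<close>

lemma (in linear_map) dim_eq_if_bij:
  assumes inj: "inj_on T (carrier V)" and surj: "T ` carrier V = carrier W"
  shows "V.dim = W.dim"
proof -
  have gen: "W.module.gen_set (T ` A) \<longleftrightarrow> V.module.gen_set A" if "finite A" "A \<subseteq> carrier V" for A
    using span_image [OF inj that] surj V.module.span_is_subset2 [OF that(2)]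
      inj_on_image_eq_iff [OF inj] by (metis order_refl)
  have "(\<exists>A. finite A \<and> card A = n \<and> A \<subseteq> carrier V \<and> V.module.gen_set A) \<longleftrightarrow>
      (\<exists>B. finite B \<and> card B = n \<and> B \<subseteq> carrier W \<and> W.module.gen_set B)" for n
  proof
    assume "\<exists>A. finite A \<and> card A = n \<and> A \<subseteq> carrier V \<and> V.module.gen_set A"
    then obtain A where A: "finite A" "card A = n" "A \<subseteq> carrier V" "V.module.gen_set A"
      by blast
    then show "\<exists>B. finite B \<and> card B = n \<and> B \<subseteq> carrier W \<and> W.module.gen_set B"
      using gen [OF A(1,3)] card_image [OF inj_on_subset [OF inj A(3)]]
      by (intro exI [of _ "T ` A"]) auto
  next
    assume "\<exists>B. finite B \<and> card B = n \<and> B \<subseteq> carrier W \<and> W.module.gen_set B"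
    then obtain B where B: "finite B" "card B = n" "B \<subseteq> carrier W" "W.module.gen_set B"
      by blast
    obtain A where A: "A \<subseteq> carrier V" "finite A" "T ` A = B"
      using B surj by (metis finite_subset_image)
    then show "\<exists>A. finite A \<and> card A = n \<and> A \<subseteq> carrier V \<and> V.module.gen_set A"
      using gen [OF A(2,1)] B card_image [OF inj_on_subset [OF inj A(1)]] by auto
  qed
  then show ?thesis
    unfolding V.dim_def W.dim_def by simp
qed

text \<open>Closure under negation comes from multiplying by \<open>-1\<close>. The lemma opens the
  coset calculus of \<open>abelian_subgroup\<close> to submodules.\<close>

lemma submodule_imp_abelian_subgroup:
  assumes "submodule R N M"
  shows "abelian_subgroup N M"
proof -
  interpret submodule R N M by fact
  interpret M: Module.module R M by (rule module)
  have "\<ominus>\<^bsub>M\<^esub> x \<in> N" if "x \<in> N" for x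
    using that subset by (metis M.smult_minus_1 M.R.add.inv_closed M.R.one_closed smult_closed subsetD)
  then have "subgroup N (add_monoid M)"
    using subset zero_closed by (intro M.add.subgroupI) (auto simp flip: a_inv_def simp del: zero_closed)
  then show ?thesis
    by (intro abelian_subgroupI3 additive_subgroup.intro M.abelian_group_axioms)
qed

lemma carrier_quotient_module:
  "carrier (quotient_module M N) = (\<lambda>x. N +>\<^bsub>M\<^esub> x) ` carrier M"
  by (auto simp: quotient_module_def A_RCOSETS_def')

text \<open>\<open>induced_map\<close> takes a union over all representatives. Two of them differ by
  some \<open>n\<close> in \<open>N\<close> and their images by \<open>f n\<close> in
  \<open>D\<close>, so all cosets in the union coincide; the union is not empty because
  \<open>x\<close> is among the representatives.\<close>

lemma induced_map_coset:
  assumes N: "submodule R N M" and D: "submodule R D V" and f: "f \<in> module_hom R M V"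
    and fN: "f ` N \<subseteq> D" and x: "x \<in> carrier M"
  shows "induced_map V D f (N +>\<^bsub>M\<^esub> x) = D +>\<^bsub>V\<^esub> f x"
proof -
  interpret N: submodule R N M by fact
  interpret D: submodule R D V by fact
  interpret M: Module.module R M by (rule N.module)
  interpret NM: abelian_subgroup N M by (rule submodule_imp_abelian_subgroup) fact
  interpret DV: abelian_subgroup D V by (rule submodule_imp_abelian_subgroup) fact
  have fx: "f y \<in> carrier V" if "y \<in> carrier M" for y
    using that f by (auto simp: module_hom_def)
  have eq: "D +>\<^bsub>V\<^esub> f y = D +>\<^bsub>V\<^esub> f x" if y: "y \<in> N +>\<^bsub>M\<^esub> x" for y
  proof -
    obtain n where n: "n \<in> N" "y = n \<oplus>\<^bsub>M\<^esub> x"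
      using y by (auto simp: a_r_coset_def')
    then have "f y = f n \<oplus>\<^bsub>V\<^esub> f x"
      using f x N.subset by (auto simp: module_hom_add)
    then have "f y \<in> D +>\<^bsub>V\<^esub> f x"
      using n fN by (auto simp: a_r_coset_def')
    then show ?thesis
      using DV.a_repr_independence' fx x by (metis DV.a_subgroup DV.a_repr_independence)
  qed
  have "x \<in> N +>\<^bsub>M\<^esub> x"
    using x by (simp add: NM.a_rcos_self)
  then have "N +>\<^bsub>M\<^esub> x \<noteq> {}"
    by (metis empty_iff)
  then show ?thesis
    unfolding induced_map_def by (rule SUP_eq_const) (rule eq)
qed

text \<open>The scalar multiplication of \<open>quotient_module\<close> has the form of an
  \<open>induced_map\<close>. With this lemma its independence of representatives is an instance of
  \<open>induced_map_coset\<close>.\<close>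

lemma smult_module_hom:
  assumes "Module.module R M" "c \<in> carrier R"
  shows "(\<lambda>x. c \<odot>\<^bsub>M\<^esub> x) \<in> module_hom R M M"
proof -
  interpret M: Module.module R M by fact
  show ?thesis
    using assms(2) M.m_comm by (auto simp: module_hom_def M.smult_r_distr simp flip: M.smult_assoc1)
qed

lemma quotient_module_simps:
  assumes N: "submodule R N M"
  shows "\<zero>\<^bsub>quotient_module M N\<^esub> = N"
    and "\<lbrakk>x \<in> carrier M; y \<in> carrier M\<rbrakk> \<Longrightarrow>
      (N +>\<^bsub>M\<^esub> x) \<oplus>\<^bsub>quotient_module M N\<^esub> (N +>\<^bsub>M\<^esub> y) = N +>\<^bsub>M\<^esub> (x \<oplus>\<^bsub>M\<^esub> y)"
    and "\<lbrakk>c \<in> carrier R; x \<in> carrier M\<rbrakk> \<Longrightarrow>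
      c \<odot>\<^bsub>quotient_module M N\<^esub> (N +>\<^bsub>M\<^esub> x) = N +>\<^bsub>M\<^esub> (c \<odot>\<^bsub>M\<^esub> x)"
proof -
  interpret N: submodule R N M by fact
  interpret NM: abelian_subgroup N M by (rule submodule_imp_abelian_subgroup) fact
  show "\<zero>\<^bsub>quotient_module M N\<^esub> = N"
    by (simp add: quotient_module_def)
  show "(N +>\<^bsub>M\<^esub> x) \<oplus>\<^bsub>quotient_module M N\<^esub> (N +>\<^bsub>M\<^esub> y) = N +>\<^bsub>M\<^esub> (x \<oplus>\<^bsub>M\<^esub> y)"
    if "x \<in> carrier M" "y \<in> carrier M"
    using that by (simp add: quotient_module_def NM.a_rcos_sum)
  show "c \<odot>\<^bsub>quotient_module M N\<^esub> (N +>\<^bsub>M\<^esub> x) = N +>\<^bsub>M\<^esub> (c \<odot>\<^bsub>M\<^esub> x)"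
    if "c \<in> carrier R" "x \<in> carrier M"
  proof -
    have "(\<lambda>x. c \<odot>\<^bsub>M\<^esub> x) ` N \<subseteq> N"
      using that N.smult_closed by auto
    from induced_map_coset [OF N N smult_module_hom [OF N.module that(1)] this that(2)]
    show ?thesis
      by (simp add: quotient_module_def induced_map_def)
  qed
qed

lemma module_quotient_module:
  assumes N: "submodule R N M"
  shows "Module.module R (quotient_module M N)"
proof -
  interpret N: submodule R N M by fact
  interpret M: Module.module R M by (rule N.module)
  interpret NM: abelian_subgroup N M by (rule submodule_imp_abelian_subgroup) fact
  note qs = quotient_module_simps [OF N] and car = carrier_quotient_module [of M N]
  have zero: "N = N +>\<^bsub>M\<^esub> \<zero>\<^bsub>M\<^esub>"
    using NM.a_subset by simp
  show ?thesis
  proof (rule moduleI)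
    show "cring R" ..
    show "abelian_group (quotient_module M N)"
    proof (rule abelian_groupI)
      show "\<zero>\<^bsub>quotient_module M N\<^esub> \<in> carrier (quotient_module M N)"
        unfolding qs(1) car using zero by blast
      show "\<exists>y\<in>carrier (quotient_module M N). y \<oplus>\<^bsub>quotient_module M N\<^esub> x = \<zero>\<^bsub>quotient_module M N\<^esub>"
        if x: "x \<in> carrier (quotient_module M N)" for x
      proof -
        obtain u where u: "u \<in> carrier M" "x = N +>\<^bsub>M\<^esub> u"
          using x by (auto simp: car)
        then have "(N +>\<^bsub>M\<^esub> (\<ominus>\<^bsub>M\<^esub> u)) \<oplus>\<^bsub>quotient_module M N\<^esub> x = \<zero>\<^bsub>quotient_module M N\<^esub>"
          using zero by (simp add: qs M.l_neg)
        then show ?thesis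
          using u by (auto simp: car)
      qed
      show "\<zero>\<^bsub>quotient_module M N\<^esub> \<oplus>\<^bsub>quotient_module M N\<^esub> x = x"
        if x: "x \<in> carrier (quotient_module M N)" for x
      proof -
        obtain u where u: "u \<in> carrier M" "x = N +>\<^bsub>M\<^esub> u"
          using x by (auto simp: car)
        then have "(N +>\<^bsub>M\<^esub> \<zero>\<^bsub>M\<^esub>) \<oplus>\<^bsub>quotient_module M N\<^esub> x = x"
          by (simp add: qs del: M.a_coset_add_zero)
        then show ?thesis
          using zero by (simp add: qs)
      qed
    qed (auto simp: car qs M.a_assoc, (simp add: M.a_comm)+)
  qed (auto simp: car qs M.smult_l_distr M.smult_r_distr M.smult_assoc1)
qed

lemma vectorspace_quotient_module:
  assumes "vectorspace K V" "submodule K N V"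
  shows "vectorspace K (quotient_module V N)"
  using assms module_quotient_module by (auto simp: vectorspace_def)

lemma induced_map_module_hom:
  assumes N: "submodule R N M" and D: "submodule R D V" and f: "f \<in> module_hom R M V"
    and fN: "f ` N \<subseteq> D"
  shows "induced_map V D f \<in> module_hom R (quotient_module M N) (quotient_module V D)"
proof -
  interpret N: submodule R N M by fact
  interpret M: Module.module R M by (rule N.module)
  have "f x \<in> carrier V" if "x \<in> carrier M" for x
    using that f by (auto simp: module_hom_def)
  then show ?thesis
    using f unfolding module_hom_def [of R "quotient_module M N"]
    by (auto simp: carrier_quotient_module quotient_module_simps [OF N] quotient_module_simps [OF D]
        induced_map_coset [OF N D f fN] module_hom_add module_hom_smult)
qed

text \<open>First isomorphism theorem: \<open>T\<close> is constant on the cosets of its kernel, and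
  the map that it induces on them is a linear bijection onto \<open>W\<close>.\<close>

lemma dim_quotient_kernel:
  fixes V :: "('k, 'v) module"
  assumes "linear_map K V W T" and surj: "T ` carrier V = carrier W"
  shows "vectorspace.dim K (quotient_module V {x \<in> carrier V. T x = \<zero>\<^bsub>W\<^esub>}) = vectorspace.dim K W"
proof -
  interpret T: linear_map K V W T by fact
  define N where "N = {x \<in> carrier V. T x = \<zero>\<^bsub>W\<^esub>}"
  have N: "submodule K N V"
    using T.ker_is_submodule by (simp add: N_def T.ker_def)
  interpret NV: abelian_subgroup N V by (rule submodule_imp_abelian_subgroup) (rule N)
  define Q where "Q = quotient_module V N"
  \<comment> \<open>The image of a coset is a singleton, so \<open>the_elem\<close> reads off its
    value without a choice of representative.\<close>
  define g where "g C = the_elem (T ` C)" for C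
  have g: "g (N +>\<^bsub>V\<^esub> x) = T x" if x: "x \<in> carrier V" for x
  proof -
    have "T y = T x" if y: "y \<in> N +>\<^bsub>V\<^esub> x" for y
    proof -
      obtain n where "n \<in> carrier V" "T n = \<zero>\<^bsub>W\<^esub>" "y = n \<oplus>\<^bsub>V\<^esub> x"
        using y unfolding a_r_coset_def' N_def by blast
      then show ?thesis
        using x by (simp add: T.T_add)
    qed
    moreover have "x \<in> N +>\<^bsub>V\<^esub> x"
      using x by (simp add: NV.a_rcos_self)
    ultimately have "T ` (N +>\<^bsub>V\<^esub> x) = {T x}"
      by (intro equalityI subsetI) (metis imageE singletonI, metis imageI singletonD)
    then show ?thesis
      by (simp add: g_def)
  qed
  have car: "carrier Q = (\<lambda>x. N +>\<^bsub>V\<^esub> x) ` carrier V"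
    by (simp add: Q_def carrier_quotient_module)
  have ghom: "g \<in> module_hom K Q W"
    unfolding module_hom_def
    by (auto simp: car quotient_module_simps [OF N, folded Q_def] g)
  have vQ: "vectorspace K Q"
    unfolding Q_def by (rule vectorspace_quotient_module [OF _ N]) (rule T.V.vectorspace_axioms)
  have "linear_map K Q W g"
    using ghom vQ T.W.vectorspace_axioms vectorspace.axioms(1) [OF vQ]
      vectorspace.axioms(1) [OF T.W.vectorspace_axioms]
    unfolding linear_map_def mod_hom_def mod_hom_axioms_def by blast
  then interpret G: linear_map K Q W g .
  have "inj_on g (carrier Q)"
  proof (rule inj_onI)
    fix C C' assume CC': "C \<in> carrier Q" "C' \<in> carrier Q" "g C = g C'"
    obtain x where x: "x \<in> carrier V" "C = N +>\<^bsub>V\<^esub> x"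
      using CC'(1) unfolding car by (rule imageE)
    obtain y where y: "y \<in> carrier V" "C' = N +>\<^bsub>V\<^esub> y"
      using CC'(2) unfolding car by (rule imageE)
    have "T x = T y"
      using CC'(3) x y g by metis
    then have "x \<ominus>\<^bsub>V\<^esub> y \<in> N"
      using x(1) y(1) unfolding N_def by (simp add: T.T_minus)
    then have "x \<in> N +>\<^bsub>V\<^esub> y"
      unfolding a_minus_def by (rule NV.a_rcos_module_rev [OF y(1) x(1)])
    then show "C = C'"
      unfolding x(2) y(2) using NV.a_repr_independence' y(1) by metis
  qed
  moreover have "g ` carrier Q = carrier W"
    unfolding car image_image surj [symmetric] by (rule image_cong [OF refl g])
  ultimately have "vectorspace.dim K Q = vectorspace.dim K W"
    by (rule G.dim_eq_if_bij)
  then show ?thesis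
    unfolding Q_def N_def .
qed

lemma submodule_restrict:
  assumes "submodule R N M" "submodule R F M" "N \<subseteq> F"
  shows "submodule R N (M\<lparr>carrier := F\<rparr>)"
proof -
  interpret N: submodule R N M by fact
  interpret M: Module.module R M by (rule N.module)
  show ?thesis
    using assms M.submodule_is_module [OF assms(2)] by (auto simp: submodule_def)
qed

text \<open>Cosets, sums of sets and induced maps depend on the addition of a module and not on its
  carrier. Quotients of subspaces can thus be computed in the ambient space.\<close>

lemma coset_restrict [simp]: "N +>\<^bsub>M\<lparr>carrier := F\<rparr>\<^esub> x = N +>\<^bsub>M\<^esub> x"
  by (simp add: a_r_coset_def')

lemma set_add_restrict [simp]: "set_add (M\<lparr>carrier := F\<rparr>) = set_add M"
  by (simp add: set_add_def' fun_eq_iff)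

lemma module_hom_restrict:
  assumes "f \<in> module_hom R M V" "Z \<subseteq> carrier M"
  shows "f \<in> module_hom R (M\<lparr>carrier := Z\<rparr>) V"
  using assms unfolding module_hom_def by (simp add: Pi_iff subset_iff)

lemma induced_map_restrict [simp]: "induced_map (V\<lparr>carrier := F\<rparr>) D f = induced_map V D f"
  by (simp add: induced_map_def fun_eq_iff)

lemma submodule_image:
  assumes N: "submodule R N M" and V: "Module.module R V" and f: "f \<in> module_hom R (M\<lparr>carrier := N\<rparr>) V"
  shows "submodule R (f ` N) V"
proof -
  interpret N: submodule R N M by fact
  interpret M: Module.module R M by (rule N.module)
  interpret f: mod_hom R "M\<lparr>carrier := N\<rparr>" V f
    by (intro mod_hom.intro mod_hom_axioms.intro M.submodule_is_module N V f)
  show ?thesis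
    using f.im_is_submodule by (simp add: f.im_def)
qed

lemma submodule_inter:
  assumes "submodule R N M" "submodule R F M"
  shows "submodule R (N \<inter> F) M"
  using assms by (auto simp: submodule_def)

text \<open>The linear algebra behind \<open>G\<^sub>\<partial> \<cong> (im \<partial> \<inter> im \<partial>bar) / im \<partial>\<partial>bar\<close>: the isomorphism is induced
  by \<open>d\<close>, and its kernel consists of the classes of \<open>d\<close>-closed elements.\<close>

lemma dim_double_quotient:
  fixes V :: "('k, 'v) module"
  assumes vs: "vectorspace K V" and F: "submodule K F V" and Z: "submodule K Z V"
    and N: "submodule K N V" and D: "submodule K D V" and I: "submodule K I V"
    and ZF: "Z \<subseteq> F" and NZ: "N \<subseteq> Z" and IN: "I \<subseteq> N" and I0: "\<And>x. x \<in> I \<Longrightarrow> d x = \<zero>\<^bsub>V\<^esub>"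
    and d: "d \<in> module_hom K (V\<lparr>carrier := F\<rparr>) V" and dN: "d ` N \<subseteq> D"
    and dvals: "\<And>x. \<lbrakk>x \<in> F; d x \<in> D\<rbrakk> \<Longrightarrow> x \<in> Z"
  defines "H \<equiv> quotient_module (V\<lparr>carrier := Z\<rparr>) N"
  shows "vectorspace.dim K (quotient_module
      (H\<lparr>carrier := {C \<in> carrier H. induced_map V D d C = D}\<rparr>)
      (induced_map V N (\<lambda>x. x) ` carrier (quotient_module (V\<lparr>carrier := {x \<in> F. d x = \<zero>\<^bsub>V\<^esub>}\<rparr>) I)))
    = vectorspace.dim K (quotient_module (V\<lparr>carrier := d ` F \<inter> D\<rparr>) (d ` N))"
proof -
  interpret V: vectorspace K V by fact
  interpret F: submodule K F V by fact
  interpret Z: submodule K Z V by fact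
  interpret N: submodule K N V by fact
  interpret D: submodule K D V by fact
  have mV: "Module.module K V" ..
  interpret NV: abelian_subgroup N V by (rule submodule_imp_abelian_subgroup) fact
  interpret DV: abelian_subgroup D V by (rule submodule_imp_abelian_subgroup) fact
  interpret d: mod_hom K "V\<lparr>carrier := F\<rparr>" V d
    by (intro mod_hom.intro mod_hom_axioms.intro V.module.submodule_is_module F mV d)
  have d': "d \<in> module_hom K (V\<lparr>carrier := S\<rparr>) V" if "S \<subseteq> F" for S
    using module_hom_restrict [OF d, of S] that by simp
  have dcar: "d x \<in> carrier V" if "x \<in> F" for x
    using d.f_im [of x] that by simp
  \<comment> \<open>For a double complex with \<partial> as \<open>d\<close>, \<open>F\<close>
    consists of forms, \<open>Z\<close> of the \<partial>\<partial>bar-closed ones, \<open>N\<close>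
    is im \<partial> + im \<partial>bar, \<open>I\<close> is im \<partial>, and \<open>D\<close> is
    im \<partial>bar in the target bidegree. Then \<open>W\<close> is im \<partial>\<partial>bar and
    \<open>Y\<close> is im \<partial> \<inter> im \<partial>bar.\<close>
  define W where "W = d ` N"
  define Y where "Y = d ` F \<inter> D"
  have W: "submodule K W V"
    unfolding W_def using N mV d' NZ ZF by (intro submodule_image) auto
  interpret WV: abelian_subgroup W V by (rule submodule_imp_abelian_subgroup) (rule W)
  have Y: "submodule K Y V"
    unfolding Y_def using F D mV d by (intro submodule_inter submodule_image) auto
  have WY: "W \<subseteq> Y"
    using dN NZ ZF by (auto simp: W_def Y_def)
  define KD where "KD = {x \<in> F. d x = \<zero>\<^bsub>V\<^esub>}"
  have KD: "submodule K KD V"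
  proof -
    have "submodule K KD (V\<lparr>carrier := F\<rparr>)"
      using d.ker_is_submodule by (simp add: d.ker_def KD_def)
    then show ?thesis
      using F mV by (auto simp: submodule_def)
  qed
  \<comment> \<open>\<open>dvals\<close> applies to closed elements because the subspace
    \<open>D\<close> contains zero.\<close>
  have KDZ: "KD \<subseteq> Z"
    using dvals by (auto simp: KD_def)
  have IKD: "I \<subseteq> KD"
    using I0 IN NZ ZF by (auto simp: KD_def)
  have NZ': "submodule K N (V\<lparr>carrier := Z\<rparr>)"
    by (rule submodule_restrict [OF N Z NZ])
  have vZ: "vectorspace K (V\<lparr>carrier := Z\<rparr>)"
    using vs Z by (intro V.subspace_is_vs) (simp add: subspace_def)
  have vH: "vectorspace K H"
    unfolding H_def by (rule vectorspace_quotient_module [OF vZ NZ'])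
  have carH: "carrier H = (\<lambda>x. N +>\<^bsub>V\<^esub> x) ` Z"
    by (simp add: H_def carrier_quotient_module)
  have indD: "induced_map V D d (N +>\<^bsub>V\<^esub> x) = D +>\<^bsub>V\<^esub> d x" if "x \<in> Z" for x
    using induced_map_coset [OF NZ' D d' [OF ZF] dN, of x] that by simp
  have indW: "induced_map V W d (N +>\<^bsub>V\<^esub> x) = W +>\<^bsub>V\<^esub> d x" if "x \<in> Z" for x
    using induced_map_coset [OF NZ' W d' [OF ZF], of x] that by (simp add: W_def)
  have indN: "induced_map V N (\<lambda>x. x) (I +>\<^bsub>V\<^esub> x) = N +>\<^bsub>V\<^esub> x" if "x \<in> KD" for x
  proof -
    have "(\<lambda>x. x) \<in> module_hom K (V\<lparr>carrier := KD\<rparr>) V"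
      using KD by (auto simp: module_hom_def submodule_def)
    from induced_map_coset [OF submodule_restrict [OF I KD IKD] N this, of x]
    show ?thesis
      using IN that by simp
  qed
  have coset_eq_D: "D +>\<^bsub>V\<^esub> y = D \<longleftrightarrow> y \<in> D" if "y \<in> carrier V" for y
    using that DV.a_rcos_self DV.a_rcos_const by auto
  define S where "S = {C \<in> carrier H. induced_map V D d C = D}"
  have S_eq: "S = (\<lambda>x. N +>\<^bsub>V\<^esub> x) ` {x \<in> Z. d x \<in> D}"
  proof -
    have "induced_map V D d (N +>\<^bsub>V\<^esub> x) = D \<longleftrightarrow> d x \<in> D" if "x \<in> Z" for x
      unfolding indD [OF that] using that ZF by (intro coset_eq_D dcar) (rule subsetD)
    then show ?thesis
      unfolding S_def carH by (intro equalityI subsetI; elim CollectE conjE imageE; metis (mono_tags, lifting) image_eqI mem_Collect_eq)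
  qed
  interpret indD: mod_hom K H "quotient_module V D" "induced_map V D d"
    using induced_map_module_hom [OF NZ' D d' [OF ZF] dN] module_quotient_module [OF D]
      module_quotient_module [OF NZ']
    by (intro mod_hom.intro mod_hom_axioms.intro) (simp_all add: H_def)
  have S: "submodule K S H"
    using indD.ker_is_submodule by (simp add: indD.ker_def S_def quotient_module_simps [OF D])
  have vS: "vectorspace K (H\<lparr>carrier := S\<rparr>)"
    using vH S by (intro vectorspace.subspace_is_vs) (auto simp: subspace_def)
  define Q where "Q = quotient_module (V\<lparr>carrier := Y\<rparr>) W"
  have WY': "submodule K W (V\<lparr>carrier := Y\<rparr>)"
    by (rule submodule_restrict [OF W Y WY])
  have vQ: "vectorspace K Q"
    unfolding Q_def using vs Y by (intro vectorspace_quotient_module WY' V.subspace_is_vs) (simp add: subspace_def)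
  have carQ: "carrier Q = (\<lambda>y. W +>\<^bsub>V\<^esub> y) ` Y"
    by (simp add: Q_def carrier_quotient_module)
  \<comment> \<open>An element of \<open>Y\<close> is some \<open>d x\<close> lying in
    \<open>D\<close>. By \<open>dvals\<close> this \<open>x\<close> belongs to \<open>Z\<close>, so
    it has a class in \<open>H\<close>, and the class lies in \<open>S\<close>.\<close>
  have surj: "induced_map V W d ` S = carrier Q"
    using dvals ZF by (force simp: S_eq carQ indW image_image Y_def)
  have "induced_map V W d \<in> module_hom K H (quotient_module V W)"
    unfolding H_def by (rule induced_map_module_hom [OF NZ' W d' [OF ZF]]) (simp add: W_def)
  then have "induced_map V W d \<in> module_hom K (H\<lparr>carrier := S\<rparr>) (quotient_module V W)"
    by (rule module_hom_restrict) (auto simp: S_def)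
  moreover have "induced_map V W d \<in> S \<rightarrow> carrier Q"
    using surj by blast
  ultimately have hom: "induced_map V W d \<in> module_hom K (H\<lparr>carrier := S\<rparr>) Q"
    by (simp add: module_hom_def Q_def quotient_module_def)
  have lin: "linear_map K (H\<lparr>carrier := S\<rparr>) Q (induced_map V W d)"
    using hom vS vQ by (intro linear_map.intro mod_hom.intro mod_hom_axioms.intro) (auto simp: vectorspace_def)
  \<comment> \<open>For the inclusion from left to right, \<open>d x\<close> in \<open>W\<close>
    means \<open>d x = d n\<close> with \<open>n\<close> in \<open>N\<close>. Subtracting
    \<open>n\<close> from \<open>x\<close> keeps the coset and makes the representative
    closed.\<close>
  have "{C \<in> S. induced_map V W d C = W} = induced_map V N (\<lambda>x. x) ` carrier (quotient_module (V\<lparr>carrier := KD\<rparr>) I)"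
    (is "?L = ?R")
  proof -
    have R: "?R = (\<lambda>x. N +>\<^bsub>V\<^esub> x) ` KD"
      by (simp add: carrier_quotient_module image_image indN)
    have "N +>\<^bsub>V\<^esub> x \<in> ?L" if "x \<in> KD" for x
    proof -
      have "d x = \<zero>\<^bsub>V\<^esub>" "x \<in> Z"
        using that KDZ by (auto simp: KD_def)
      then show ?thesis
        using WV.a_subset by (simp add: S_eq indW)
    qed
    moreover have "C \<in> (\<lambda>x. N +>\<^bsub>V\<^esub> x) ` KD" if C: "C \<in> ?L" for C
    proof -
      obtain x where x: "x \<in> Z" "C = N +>\<^bsub>V\<^esub> x" "W +>\<^bsub>V\<^esub> d x = W"
        using C by (auto simp: S_eq indW)
      then have "d x \<in> W"
        using WV.a_rcos_self [of "d x"] dcar ZF by auto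
      then obtain n where n: "n \<in> N" "d x = d n"
        by (auto simp: W_def)
      have cn: "n \<in> F" "x \<in> F" "n \<in> carrier V" "x \<in> carrier V"
        using n x ZF NZ F.subset by auto
      have mn: "\<ominus>\<^bsub>V\<^esub> n \<in> N"
        using n by simp
      then have mF: "\<ominus>\<^bsub>V\<^esub> n \<in> F"
        using NZ ZF by auto
      have "d (\<ominus>\<^bsub>V\<^esub> n) \<oplus>\<^bsub>V\<^esub> d n = d (\<ominus>\<^bsub>V\<^esub> n \<oplus>\<^bsub>V\<^esub> n)"
        using d.f_add [of "\<ominus>\<^bsub>V\<^esub> n" n] cn mF by simp
      also have "\<dots> = \<zero>\<^bsub>V\<^esub>"
        using d.f0_is_0 cn by (simp add: V.module.M.l_neg)
      finally have "\<ominus>\<^bsub>V\<^esub> n \<oplus>\<^bsub>V\<^esub> x \<in> KD"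
        using d.f_add [of "\<ominus>\<^bsub>V\<^esub> n" x] cn mF n F.m_closed by (simp add: KD_def)
      moreover have "C = N +>\<^bsub>V\<^esub> (\<ominus>\<^bsub>V\<^esub> n \<oplus>\<^bsub>V\<^esub> x)"
      proof -
        have "\<ominus>\<^bsub>V\<^esub> n \<oplus>\<^bsub>V\<^esub> x \<in> N +>\<^bsub>V\<^esub> x"
          using mn by (auto simp: a_r_coset_def')
        then show ?thesis
          unfolding x(2) using cn NV.a_repr_independence' by metis
      qed
      ultimately show ?thesis
        by blast
    qed
    ultimately show ?thesis
      unfolding R by blast
  qed
  moreover have "\<zero>\<^bsub>Q\<^esub> = W"
    by (simp add: Q_def quotient_module_def)
  ultimately show ?thesis
    using dim_quotient_kernel [OF lin] surj
    by (simp add: S_def Q_def W_def Y_def KD_def)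
qed

section \<open>Double complexes\<close>

lemma submodule_kernel:
  assumes M: "submodule R F M" and V: "Module.module R V" and f: "f \<in> module_hom R (M\<lparr>carrier := F\<rparr>) V"
  shows "submodule R {x \<in> F. f x = \<zero>\<^bsub>V\<^esub>} M"
proof -
  interpret F: submodule R F M by fact
  interpret M: Module.module R M by (rule F.module)
  interpret f: mod_hom R "M\<lparr>carrier := F\<rparr>" V f
    by (intro mod_hom.intro mod_hom_axioms.intro M.submodule_is_module M V f)
  have "submodule R {x \<in> F. f x = \<zero>\<^bsub>V\<^esub>} (M\<lparr>carrier := F\<rparr>)"
    using f.ker_is_submodule by (simp add: f.ker_def)
  then show ?thesis
    using M F.module by (auto simp: submodule_def)
qed

lemma submodule_set_add:
  assumes "submodule R N M" "submodule R F M"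
  shows "submodule R (N <+>\<^bsub>M\<^esub> F) M"
proof -
  interpret N: submodule R N M by fact
  interpret F: submodule R F M by fact
  interpret M: Module.module R M by (rule F.module)
  have mem: "z \<in> N <+>\<^bsub>M\<^esub> F \<longleftrightarrow> (\<exists>x\<in>N. \<exists>y\<in>F. z = x \<oplus>\<^bsub>M\<^esub> y)" for z
    by (auto simp: set_add_def')
  have N: "x \<in> carrier M" if "x \<in> N" for x
    using that N.subset by (rule subsetD [rotated])
  have F: "x \<in> carrier M" if "x \<in> F" for x
    using that F.subset by (rule subsetD [rotated])
  show ?thesis
  proof (unfold_locales)
    show "N <+>\<^bsub>M\<^esub> F \<subseteq> carrier M"
      using N F by (auto simp: mem)
    show "v \<oplus>\<^bsub>M\<^esub> w \<in> N <+>\<^bsub>M\<^esub> F" if vw: "v \<in> N <+>\<^bsub>M\<^esub> F" "w \<in> N <+>\<^bsub>M\<^esub> F" for v w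
    proof -
      obtain x y x' y' where xy: "x \<in> N" "y \<in> F" "x' \<in> N" "y' \<in> F" "v = x \<oplus>\<^bsub>M\<^esub> y" "w = x' \<oplus>\<^bsub>M\<^esub> y'"
        using vw unfolding mem by blast
      then have "v \<oplus>\<^bsub>M\<^esub> w = (x \<oplus>\<^bsub>M\<^esub> x') \<oplus>\<^bsub>M\<^esub> (y \<oplus>\<^bsub>M\<^esub> y')"
        using N F by (simp add: M.a_ac)
      then show ?thesis
        unfolding mem using xy N.m_closed F.m_closed by metis
    qed
    show "\<zero>\<^bsub>M\<^esub> \<in> N <+>\<^bsub>M\<^esub> F"
      unfolding mem using N.zero_closed F.zero_closed M.l_zero M.zero_closed by metis
    show "c \<odot>\<^bsub>M\<^esub> v \<in> N <+>\<^bsub>M\<^esub> F" if c: "c \<in> carrier R" and v: "v \<in> N <+>\<^bsub>M\<^esub> F" for c v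
    proof -
      obtain x y where xy: "x \<in> N" "y \<in> F" "v = x \<oplus>\<^bsub>M\<^esub> y"
        using v unfolding mem by blast
      then have "c \<odot>\<^bsub>M\<^esub> v = c \<odot>\<^bsub>M\<^esub> x \<oplus>\<^bsub>M\<^esub> c \<odot>\<^bsub>M\<^esub> y"
        using N F c by (simp add: M.smult_r_distr)
      then show ?thesis
        unfolding mem using xy c N.smult_closed F.smult_closed by metis
    qed
  qed
qed

lemma module_hom_compose:
  assumes "f \<in> module_hom R (V\<lparr>carrier := A\<rparr>) V" "g \<in> module_hom R (V\<lparr>carrier := B\<rparr>) W" "f ` A \<subseteq> B"
  shows "(\<lambda>x. g (f x)) \<in> module_hom R (V\<lparr>carrier := A\<rparr>) W"
proof -
  have "f x \<in> B" if "x \<in> A" for x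
    using that assms(3) by blast
  then show ?thesis
    using assms(1,2) by (auto simp: module_hom_def Pi_iff)
qed

text \<open>All bidegrees share one ambient space. The operators are total functions, required to be
  linear only on each \<open>F p q\<close>, as derivatives behave well only on smooth forms. Integer
  indices make \<open>p - 1\<close> and \<open>q - 1\<close> available without side
  conditions.\<close>

locale double_complex =
  fixes K :: "('k, 'e) ring_scheme" and V :: "('k, 'v) module"
    and F :: "int \<Rightarrow> int \<Rightarrow> 'v set" and d d' :: "'v \<Rightarrow> 'v"
  assumes vs: "vectorspace K V"
    and F: "submodule K (F p q) V"
    and d_hom: "d \<in> module_hom K (V\<lparr>carrier := F p q\<rparr>) V"
    and d'_hom: "d' \<in> module_hom K (V\<lparr>carrier := F p q\<rparr>) V"
    and d_closed: "x \<in> F p q \<Longrightarrow> d x \<in> F (p + 1) q"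
    and d'_closed: "x \<in> F p q \<Longrightarrow> d' x \<in> F p (q + 1)"
    and d_d: "x \<in> F p q \<Longrightarrow> d (d x) = \<zero>\<^bsub>V\<^esub>"
    and d'_d': "x \<in> F p q \<Longrightarrow> d' (d' x) = \<zero>\<^bsub>V\<^esub>"
    and anti: "x \<in> F p q \<Longrightarrow> d (d' x) = \<ominus>\<^bsub>V\<^esub> d' (d x)"
begin

lemma module_V: "Module.module K V"
  using vs by (simp add: vectorspace_def)

lemma F_carrier: "x \<in> F p q \<Longrightarrow> x \<in> carrier V"
  using F [of p q] by (auto simp: submodule_def)

lemma F_add: "\<lbrakk>x \<in> F p q; y \<in> F p q\<rbrakk> \<Longrightarrow> x \<oplus>\<^bsub>V\<^esub> y \<in> F p q"
  using F [of p q] by (auto simp: submodule_def)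

lemma F_neg: "x \<in> F p q \<Longrightarrow> \<ominus>\<^bsub>V\<^esub> x \<in> F p q"
proof -
  interpret abelian_subgroup "F p q" V
    by (rule submodule_imp_abelian_subgroup [OF F])
  show "x \<in> F p q \<Longrightarrow> \<ominus>\<^bsub>V\<^esub> x \<in> F p q"
    by simp
qed

lemma F_mod_hom:
  assumes "f \<in> module_hom K (V\<lparr>carrier := F p q\<rparr>) V"
  shows "mod_hom K (V\<lparr>carrier := F p q\<rparr>) V f"
  using assms LinearCombinations.module.submodule_is_module [OF module_V F]
  by (intro mod_hom.intro mod_hom_axioms.intro module_V) auto

lemma F_hom_neg:
  assumes f: "f \<in> module_hom K (V\<lparr>carrier := F p q\<rparr>) V" and x: "x \<in> F p q"
  shows "f (\<ominus>\<^bsub>V\<^esub> x) = \<ominus>\<^bsub>V\<^esub> f x"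
proof -
  interpret V: Module.module K V by (rule module_V)
  interpret f: mod_hom K "V\<lparr>carrier := F p q\<rparr>" V f
    by (rule F_mod_hom [OF f])
  have "f (\<ominus>\<^bsub>V\<^esub> x) \<oplus>\<^bsub>V\<^esub> f x = f (\<ominus>\<^bsub>V\<^esub> x \<oplus>\<^bsub>V\<^esub> x)"
    using f.f_add [of "\<ominus>\<^bsub>V\<^esub> x" x] x F_neg by simp
  also have "\<dots> = \<zero>\<^bsub>V\<^esub>"
    using f.f0_is_0 x F_carrier by (simp add: V.l_neg)
  finally show ?thesis
    using f.f_im [of x] f.f_im [of "\<ominus>\<^bsub>V\<^esub> x"] x F_neg by (simp add: V.minus_equality [symmetric])
qed

lemma F_hom_zero: "f \<in> module_hom K (V\<lparr>carrier := F p q\<rparr>) V \<Longrightarrow> f \<zero>\<^bsub>V\<^esub> = \<zero>\<^bsub>V\<^esub>"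
  using mod_hom.f0_is_0 [OF F_mod_hom] by force

text \<open>\<open>H_A\<close> fixes one order of the two operators. The other order arises in the
  transposed complex and whenever \<open>d x\<close> is known to be \<open>d'\<close>-exact.\<close>

lemma anti_zero_iff:
  assumes x: "x \<in> F p q"
  shows "d (d' x) = \<zero>\<^bsub>V\<^esub> \<longleftrightarrow> d' (d x) = \<zero>\<^bsub>V\<^esub>"
proof -
  interpret V: Module.module K V by (rule module_V)
  have y: "d' (d x) \<in> carrier V"
    using F_carrier [OF d'_closed [OF d_closed [OF x]]] .
  show ?thesis
    unfolding anti [OF x]
  proof
    assume "\<ominus>\<^bsub>V\<^esub> d' (d x) = \<zero>\<^bsub>V\<^esub>"
    then have "\<ominus>\<^bsub>V\<^esub> (\<ominus>\<^bsub>V\<^esub> d' (d x)) = \<zero>\<^bsub>V\<^esub>"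
      by simp
    then show "d' (d x) = \<zero>\<^bsub>V\<^esub>"
      by (simp only: V.minus_minus [OF y])
  qed simp
qed

text \<open>Transposing the grading exchanges the roles of the operators, so each result about
  \<open>d\<close> yields its mirror image for \<open>d'\<close>. Reversing the anticommutation law
  costs a double negation.\<close>

lemma swap: "double_complex K V (\<lambda>p q. F q p) d' d"
proof -
  interpret V: Module.module K V by (rule module_V)
  show ?thesis
  proof (rule double_complex.intro)
    show "d' (d x) = \<ominus>\<^bsub>V\<^esub> d (d' x)" if "x \<in> F q p" for p q x
      using that by (metis anti V.minus_minus d_closed d'_closed F_carrier)
  qed (fact vs F d_hom d'_hom d_closed d'_closed d_d d'_d')+
qed

lemma im_submodule: "submodule K (d ` F p q) V" "submodule K (d' ` F p q) V"
  by (rule submodule_image [OF F module_V d_hom], rule submodule_image [OF F module_V d'_hom])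

text \<open>An instance of \<open>dim_double_quotient\<close>. The work lies in its side conditions:
  the image of \<open>N\<close> under \<open>d\<close>, and the fact that
  \<open>d'\<close>-exactness of \<open>d x\<close> makes \<open>x\<close> an Aeppli
  cocycle.\<close>

lemma dim_G:
  fixes p q :: int
  defines "N \<equiv> d ` F (p - 1) q <+>\<^bsub>V\<^esub> d' ` F p (q - 1)"
  defines "H \<equiv> quotient_module (V\<lparr>carrier := {x \<in> F p q. d (d' x) = \<zero>\<^bsub>V\<^esub>}\<rparr>) N"
  shows "vectorspace.dim K (quotient_module
      (H\<lparr>carrier := {C \<in> carrier H. induced_map V (d' ` F (p + 1) (q - 1)) d C = d' ` F (p + 1) (q - 1)}\<rparr>)
      (induced_map V N (\<lambda>x. x) ` carrier (quotient_module (V\<lparr>carrier := {x \<in> F p q. d x = \<zero>\<^bsub>V\<^esub>}\<rparr>) (d ` F (p - 1) q))))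
    = vectorspace.dim K (quotient_module (V\<lparr>carrier := d ` F p q \<inter> d' ` F (p + 1) (q - 1)\<rparr>)
      ((\<lambda>x. d (d' x)) ` F p (q - 1)))"
proof -
  interpret V: Module.module K V by (rule module_V)
  have dF: "d x \<in> F p q" if "x \<in> F (p - 1) q" for x
    using d_closed [OF that] by simp
  have d'F: "d' x \<in> F p q" if "x \<in> F p (q - 1)" for x
    using d'_closed [OF that] by simp
  have NE: "N = {d a \<oplus>\<^bsub>V\<^esub> d' b | a b. a \<in> F (p - 1) q \<and> b \<in> F p (q - 1)}"
    unfolding N_def set_add_def' by blast
  have N: "submodule K N V"
    unfolding N_def by (intro submodule_set_add im_submodule)
  have add: "f (x \<oplus>\<^bsub>V\<^esub> y) = f x \<oplus>\<^bsub>V\<^esub> f y"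
    if "f \<in> module_hom K (V\<lparr>carrier := F p q\<rparr>) V" "x \<in> F p q" "y \<in> F p q" for f x y p q
    using module_hom_add [OF that(1)] that(2,3) by simp
  have hom2: "(\<lambda>x. d (d' x)) \<in> module_hom K (V\<lparr>carrier := F p q\<rparr>) V"
    using d'_closed by (intro module_hom_compose [OF d'_hom d_hom]) auto
  have Z: "submodule K {x \<in> F p q. d (d' x) = \<zero>\<^bsub>V\<^esub>} V"
    by (rule submodule_kernel [OF F module_V hom2])
  have dN: "d (d a \<oplus>\<^bsub>V\<^esub> d' b) = d (d' b)" if "a \<in> F (p - 1) q" "b \<in> F p (q - 1)" for a b
  proof -
    have "d (d' b) \<in> carrier V"
      using that d_closed d'_closed F_carrier by blast
    then show ?thesis
      using add [OF d_hom dF d'F] that by (simp add: d_d)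
  qed
  \<comment> \<open>\<open>d\<close> kills the summand \<open>d a\<close>, so only the
    \<open>d'\<close>-part of \<open>N\<close> contributes; taking \<open>a\<close> to be zero
    reaches every \<open>d (d' b)\<close>.\<close>
  have im: "d ` N = (\<lambda>x. d (d' x)) ` F p (q - 1)"
  proof -
    have "\<zero>\<^bsub>V\<^esub> \<in> F (p - 1) q"
      using F [of "p - 1" q] by (auto simp: submodule_def)
    then show ?thesis
      unfolding NE using dN by (force simp: image_iff)
  qed
  have dd'D: "d (d' b) \<in> d' ` F (p + 1) (q - 1)" if b: "b \<in> F p (q - 1)" for b
  proof -
    have db: "d b \<in> F (p + 1) (q - 1)"
      by (rule d_closed [OF b])
    \<comment> \<open>The sign is moved onto the preimage, which becomes the negative of
      \<open>d b\<close>.\<close>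
    have "d (d' b) = d' (\<ominus>\<^bsub>V\<^esub> d b)"
      unfolding anti [OF b] by (rule F_hom_neg [OF d'_hom db, symmetric])
    then show ?thesis
      using F_neg [OF db] by blast
  qed
  have NZ: "N \<subseteq> {x \<in> F p q. d (d' x) = \<zero>\<^bsub>V\<^esub>}"
  proof
    fix x assume "x \<in> N"
    then obtain a b where ab: "a \<in> F (p - 1) q" "b \<in> F p (q - 1)" "x = d a \<oplus>\<^bsub>V\<^esub> d' b"
      unfolding NE by blast
    have xF: "x \<in> F p q"
      unfolding ab using ab dF d'F by (intro F_add)
    have "d' (d x) = \<zero>\<^bsub>V\<^esub>"
    proof -
      have "d x \<in> d' ` F (p + 1) (q - 1)"
        unfolding ab(3) dN [OF ab(1,2)] by (rule dd'D [OF ab(2)])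
      then show ?thesis
        using d'_d' by (metis imageE)
    qed
    then show "x \<in> {x \<in> F p q. d (d' x) = \<zero>\<^bsub>V\<^esub>}"
      using xF anti_zero_iff [OF xF] by blast
  qed
  have IN: "d ` F (p - 1) q \<subseteq> N"
  proof
    fix x assume "x \<in> d ` F (p - 1) q"
    then obtain a where a: "a \<in> F (p - 1) q" "x = d a"
      by blast
    have z: "\<zero>\<^bsub>V\<^esub> \<in> F p (q - 1)"
      using F [of p "q - 1"] by (auto simp: submodule_def)
    have "x = d a \<oplus>\<^bsub>V\<^esub> d' \<zero>\<^bsub>V\<^esub>"
      using a F_carrier [OF dF [OF a(1)]] by (simp add: F_hom_zero [OF d'_hom])
    then show "x \<in> N"
      unfolding NE using a z by blast
  qed
  have "vectorspace.dim K (quotient_module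
      (H\<lparr>carrier := {C \<in> carrier H. induced_map V (d' ` F (p + 1) (q - 1)) d C = d' ` F (p + 1) (q - 1)}\<rparr>)
      (induced_map V N (\<lambda>x. x) ` carrier (quotient_module (V\<lparr>carrier := {x \<in> F p q. d x = \<zero>\<^bsub>V\<^esub>}\<rparr>) (d ` F (p - 1) q))))
    = vectorspace.dim K (quotient_module (V\<lparr>carrier := d ` F p q \<inter> d' ` F (p + 1) (q - 1)\<rparr>) (d ` N))"
    unfolding H_def
  proof (rule dim_double_quotient [OF vs F Z N im_submodule(2) im_submodule(1) _ NZ IN _ d_hom])
    show "d ` N \<subseteq> d' ` F (p + 1) (q - 1)"
      unfolding im using dd'D by blast
    \<comment> \<open>If \<open>d x = d' y\<close>, then \<open>d' (d x)\<close> vanishes, and by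
      anticommutation so does \<open>d (d' x)\<close>.\<close>
    show "x \<in> {x \<in> F p q. d (d' x) = \<zero>\<^bsub>V\<^esub>}" if "x \<in> F p q" "d x \<in> d' ` F (p + 1) (q - 1)" for x
      using that d'_d' anti_zero_iff [OF that(1)] by (metis (mono_tags, lifting) imageE mem_Collect_eq)
  qed (use d_d in blast)+
  then show ?thesis
    unfolding im .
qed

text \<open>The value of \<open>d d'\<close> at \<open>x\<close> is that of \<open>d' d\<close> at
  the negative of \<open>x\<close>. These images are the denominators obtained from the two sides of
  the theorem.\<close>

lemma image_anticommute: "(\<lambda>x. d (d' x)) ` F p q = (\<lambda>x. d' (d x)) ` F p q"
proof -
  have "d (d' x) = d' (d (\<ominus>\<^bsub>V\<^esub> x))" if x: "x \<in> F p q" for x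
    by (simp only: anti [OF x] F_hom_neg [OF d_hom x] F_hom_neg [OF d'_hom d_closed [OF x]])
  moreover have "d' (d x) = d (d' (\<ominus>\<^bsub>V\<^esub> x))" if x: "x \<in> F p q" for x
  proof -
    interpret V: Module.module K V by (rule module_V)
    have "d' (d x) = \<ominus>\<^bsub>V\<^esub> d (d' x)"
      unfolding anti [OF x] using F_carrier [OF d'_closed [OF d_closed [OF x]]] by simp
    then show ?thesis
      by (simp only: F_hom_neg [OF d'_hom x] F_hom_neg [OF d_hom d'_closed [OF x]])
  qed
  ultimately show ?thesis
    using F_neg [of _ p q] by blast
qed

text \<open>\<open>im_A\<close> has im \<partial> as its first summand, whereas the transposed
  complex produces im \<partial>bar first.\<close>

lemma im_sum_commute: "d ` F p q <+>\<^bsub>V\<^esub> d' ` F p' q' = d' ` F p' q' <+>\<^bsub>V\<^esub> d ` F p q"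
proof -
  interpret V: Module.module K V by (rule module_V)
  have "d x \<oplus>\<^bsub>V\<^esub> d' y = d' y \<oplus>\<^bsub>V\<^esub> d x" if "x \<in> F p q" "y \<in> F p' q'" for x y
    using F_carrier [OF d_closed [OF that(1)]] F_carrier [OF d'_closed [OF that(2)]] by (rule V.a_comm)
  then show ?thesis
    unfolding set_add_def' by (fastforce simp: image_iff)
qed

end

section \<open>Smooth functions\<close>

lemma differentiable_cong_open:
  assumes "open S" "x \<in> S" "\<And>y. y \<in> S \<Longrightarrow> f y = g y" "f differentiable (at x)"
  shows "g differentiable (at x)"
  using assms unfolding differentiable_def by (metis has_derivative_transform_within_open)

text \<open>\<open>frechet_derivative\<close> is a choice among all derivatives. Both functions have
  the same candidates at \<open>x\<close>, hence the same choice, even where no derivative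
  exists.\<close>

lemma frechet_derivative_cong_open:
  assumes S: "open S" "x \<in> S" and eq: "\<And>y. y \<in> S \<Longrightarrow> f y = g y"
  shows "frechet_derivative f (at x) = frechet_derivative g (at x)"
proof -
  have "(f has_derivative D) (at x) \<longleftrightarrow> (g has_derivative D) (at x)" for D
    using S eq by (metis has_derivative_transform_within_open)
  then show ?thesis
    by (simp add: frechet_derivative_def)
qed

lemma Ck_on_cong:
  assumes "open S" "\<And>x. x \<in> S \<Longrightarrow> f x = g x" "Ck_on k S f"
  shows "Ck_on k S g"
  using assms(2,3)
proof (induction k arbitrary: f g)
  case 0
  then show ?case
    by (simp cong: continuous_on_cong)
next
  case (Suc k)
  have "g differentiable (at x)" if "x \<in> S" for x
    using Suc.prems differentiable_cong_open [OF assms(1) that] that by auto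
  moreover have "Ck_on k S (\<lambda>x. frechet_derivative g (at x) v)" for v
  proof (rule Suc.IH)
    show "frechet_derivative f (at x) v = frechet_derivative g (at x) v" if "x \<in> S" for x
      by (rule fun_cong [OF frechet_derivative_cong_open [OF assms(1) that Suc.prems(1)]])
    show "Ck_on k S (\<lambda>x. frechet_derivative f (at x) v)"
      using Suc.prems(2) by simp
  qed
  ultimately show ?case
    by simp
qed

lemma frechet_derivative_bounded_linear_compose:
  assumes "bounded_linear L" "f differentiable (at x)"
  shows "frechet_derivative (\<lambda>x. L (f x)) (at x) v = L (frechet_derivative f (at x) v)"
proof -
  have "((\<lambda>x. L (f x)) has_derivative (\<lambda>v. L (frechet_derivative f (at x) v))) (at x)"
    using assms(2) unfolding frechet_derivative_works by (rule bounded_linear.has_derivative [OF assms(1)])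
  from fun_cong [OF frechet_derivative_at [OF this], of v] show ?thesis
    by (rule sym)
qed

lemma frechet_derivative_add':
  assumes "f differentiable (at x)" "g differentiable (at x)"
  shows "frechet_derivative (\<lambda>x. f x + g x) (at x) v =
    frechet_derivative f (at x) v + frechet_derivative g (at x) v"
proof -
  have "((\<lambda>x. f x + g x) has_derivative
      (\<lambda>v. frechet_derivative f (at x) v + frechet_derivative g (at x) v)) (at x)"
    using assms by (intro has_derivative_add) (auto simp: frechet_derivative_works)
  from fun_cong [OF frechet_derivative_at [OF this], of v] show ?thesis
    by (rule sym)
qed

lemma frechet_derivative_mult':
  fixes f g :: "'e::real_normed_vector \<Rightarrow> complex"
  assumes "f differentiable (at x)" "g differentiable (at x)"
  shows "frechet_derivative (\<lambda>x. f x * g x) (at x) v =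
    f x * frechet_derivative g (at x) v + frechet_derivative f (at x) v * g x"
proof -
  have "((\<lambda>x. f x * g x) has_derivative
      (\<lambda>v. f x * frechet_derivative g (at x) v + frechet_derivative f (at x) v * g x)) (at x)"
    using assms by (intro has_derivative_mult) (auto simp: frechet_derivative_works)
  from fun_cong [OF frechet_derivative_at [OF this], of v] show ?thesis
    by (rule sym)
qed

lemma frechet_derivative_cmult:
  fixes f :: "'e::real_normed_vector \<Rightarrow> complex"
  assumes "f differentiable (at x)"
  shows "frechet_derivative (\<lambda>x. c * f x) (at x) v = c * frechet_derivative f (at x) v"
  by (rule frechet_derivative_bounded_linear_compose [OF bounded_linear_mult_right assms])

lemma Ck_on_bounded_linear:
  assumes "open S" "bounded_linear L" "Ck_on k S f"
  shows "Ck_on k S (\<lambda>x. L (f x))"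
  using assms(3)
proof (induction k arbitrary: f)
  case 0
  then show ?case
    using assms(2) by (simp add: linear_continuous_on_compose bounded_linear.continuous_on)
next
  case (Suc k)
  have "Ck_on k S (\<lambda>x. frechet_derivative (\<lambda>x. L (f x)) (at x) v)" for v
    using Suc by (intro Ck_on_cong [OF assms(1) _ Suc.IH [of "\<lambda>x. frechet_derivative f (at x) v"]])
      (auto simp: frechet_derivative_bounded_linear_compose [OF assms(2)])
  moreover have "(\<lambda>x. L (f x)) differentiable (at x)" if "x \<in> S" for x
    using Suc.prems that bounded_linear.has_derivative [OF assms(2)]
    unfolding differentiable_def Ck_on.simps(2) by blast
  ultimately show ?case
    by simp
qed

lemma Ck_on_add:
  assumes "open S" "Ck_on k S f" "Ck_on k S g"
  shows "Ck_on k S (\<lambda>x. f x + g x)"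
  using assms(2,3)
proof (induction k arbitrary: f g)
  case 0
  then show ?case
    by (simp add: continuous_on_add)
next
  case (Suc k)
  have "Ck_on k S (\<lambda>x. frechet_derivative (\<lambda>x. f x + g x) (at x) v)" for v
  proof (rule Ck_on_cong [OF assms(1)])
    show "Ck_on k S (\<lambda>x. frechet_derivative f (at x) v + frechet_derivative g (at x) v)"
      using Suc.prems by (intro Suc.IH) auto
  qed (use Suc.prems in \<open>simp add: frechet_derivative_add'\<close>)
  then show ?case
    using Suc.prems by simp
qed

lemma smooth_on_cong: "\<lbrakk>open S; \<And>x. x \<in> S \<Longrightarrow> f x = g x; smooth_on S f\<rbrakk> \<Longrightarrow> smooth_on S g"
  unfolding smooth_on_def using Ck_on_cong [of S f g] by simp

lemma smooth_on_bounded_linear: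
  "\<lbrakk>open S; bounded_linear L; smooth_on S f\<rbrakk> \<Longrightarrow> smooth_on S (\<lambda>x. L (f x))"
  by (simp add: smooth_on_def Ck_on_bounded_linear)

lemma smooth_on_add: "\<lbrakk>open S; smooth_on S f; smooth_on S g\<rbrakk> \<Longrightarrow> smooth_on S (\<lambda>x. f x + g x)"
  by (simp add: smooth_on_def Ck_on_add)

lemma smooth_on_cmult:
  fixes f :: "'e::real_normed_vector \<Rightarrow> complex"
  shows "\<lbrakk>open S; smooth_on S f\<rbrakk> \<Longrightarrow> smooth_on S (\<lambda>x. c * f x)"
  by (rule smooth_on_bounded_linear [of S "\<lambda>x. c * x"]) (auto intro: bounded_linear_mult_right)

lemma smooth_on_sum:
  assumes "open S" "\<And>i. i \<in> A \<Longrightarrow> smooth_on S (f i)"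
  shows "smooth_on S (\<lambda>x. \<Sum>i\<in>A. f i x)"
  using assms(2) by (induction A rule: infinite_finite_induct) (auto simp: smooth_on_zero smooth_on_add assms(1))

lemma smooth_on_differentiable: "\<lbrakk>smooth_on S f; x \<in> S\<rbrakk> \<Longrightarrow> f differentiable (at x)"
  unfolding smooth_on_def using Ck_on.simps(2) [of 0 S f] by blast

lemma smooth_on_derivative: "smooth_on S f \<Longrightarrow> smooth_on S (\<lambda>x. frechet_derivative f (at x) v)"
  unfolding smooth_on_def using Ck_on.simps(2) [of _ S f] by blast

lemma smooth_on_continuous: "smooth_on S f \<Longrightarrow> continuous_on S f"
  unfolding smooth_on_def using Ck_on.simps(1) [of S f] by blast

section \<open>Symmetry of second derivatives\<close>

text \<open>The mean value theorem is applied twice: along \<open>v\<close> to the increment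
  \<open>g\<close> of \<open>f\<close> in direction \<open>w\<close>, then along \<open>w\<close> to
  the derivative \<open>k\<close> of \<open>f\<close> in direction \<open>v\<close>. The second
  difference itself is symmetric in \<open>v\<close> and \<open>w\<close>.\<close>

lemma second_difference:
  fixes f :: "'e::real_normed_vector \<Rightarrow> real"
  assumes h: "0 < h" and P: "\<And>s t. \<lbrakk>0 \<le> s; s \<le> h; 0 \<le> t; t \<le> h\<rbrakk> \<Longrightarrow> x + s *\<^sub>R v + t *\<^sub>R w \<in> S"
    and f: "\<And>y. y \<in> S \<Longrightarrow> f differentiable (at y)"
    and fv: "\<And>y. y \<in> S \<Longrightarrow> (\<lambda>y. frechet_derivative f (at y) v) differentiable (at y)"
  obtains s t where "0 < s" "s < h" "0 < t" "t < h"
    "f (x + h *\<^sub>R v + h *\<^sub>R w) - f (x + h *\<^sub>R v) - f (x + h *\<^sub>R w) + f x =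
      h * h * frechet_derivative (\<lambda>y. frechet_derivative f (at y) v) (at (x + s *\<^sub>R v + t *\<^sub>R w)) w"
proof -
  define g where "g s = f (x + s *\<^sub>R v + h *\<^sub>R w) - f (x + s *\<^sub>R v)" for s
  define g' where "g' s = frechet_derivative f (at (x + s *\<^sub>R v + h *\<^sub>R w)) v - frechet_derivative f (at (x + s *\<^sub>R v)) v" for s
  have dir: "((\<lambda>s. F (a + s *\<^sub>R u)) has_real_derivative frechet_derivative F (at (a + s *\<^sub>R u)) u) (at s)"
    if "F differentiable (at (a + s *\<^sub>R u))" for F :: "'e \<Rightarrow> real" and a u s
  proof -
    have F: "(F has_derivative frechet_derivative F (at (a + s *\<^sub>R u))) (at (a + s *\<^sub>R u))"
      using that by (simp add: frechet_derivative_works)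
    have "((\<lambda>s. a + s *\<^sub>R u) has_derivative (\<lambda>r. r *\<^sub>R u)) (at s)"
      by (auto intro!: derivative_eq_intros)
    from diff_chain_at [OF this F]
    have "((\<lambda>s. F (a + s *\<^sub>R u)) has_derivative (\<lambda>r. frechet_derivative F (at (a + s *\<^sub>R u)) (r *\<^sub>R u))) (at s)"
      by (simp add: o_def)
    then show ?thesis
      using has_derivative_linear [OF F] by (simp add: has_field_derivative_def linear_scale mult_commute_abs)
  qed
  have dg: "(g has_real_derivative g' s) (at s)" if "0 \<le> s" "s \<le> h" for s
  proof -
    have "f differentiable (at ((x + h *\<^sub>R w) + s *\<^sub>R v))" "f differentiable (at (x + s *\<^sub>R v))"
      using f [OF P [of s h]] f [OF P [of s 0]] that h by (simp_all add: add.assoc add.commute [of "h *\<^sub>R w"])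
    from DERIV_diff [OF dir [OF this(1)] dir [OF this(2)]] show ?thesis
      by (simp add: g_def [abs_def] g'_def algebra_simps)
  qed
  obtain s where s: "0 < s" "s < h" "g h - g 0 = h * g' s"
    using MVT2 [OF h, of g g'] dg by auto
  define k where "k t = frechet_derivative f (at (x + s *\<^sub>R v + t *\<^sub>R w)) v" for t
  define k' where "k' t = frechet_derivative (\<lambda>y. frechet_derivative f (at y) v) (at (x + s *\<^sub>R v + t *\<^sub>R w)) w" for t
  have dk: "(k has_real_derivative k' t) (at t)" if "0 \<le> t" "t \<le> h" for t
    using dir [OF fv [OF P, of s t]] s that by (simp add: k_def [abs_def] k'_def)
  obtain t where t: "0 < t" "t < h" "k h - k 0 = h * k' t"
    using MVT2 [OF h, of k k'] dk by auto
  have "g' s = k h - k 0"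
    by (simp add: g'_def k_def)
  then have "g h - g 0 = h * (h * k' t)"
    using s t by simp
  then have "f (x + h *\<^sub>R v + h *\<^sub>R w) - f (x + h *\<^sub>R v) - f (x + h *\<^sub>R w) + f x = h * h * k' t"
    by (simp add: g_def)
  then show ?thesis
    unfolding k'_def by (rule that [OF s(1,2) t(1,2)])
qed

text \<open>Schwarz's theorem. The second difference, computed in both orders, makes the two mixed
  derivatives attain a common value, each at its own point near \<open>x\<close>; continuity then
  excludes a gap at \<open>x\<close>.\<close>

lemma symmetric_second_derivative_real:
  fixes f :: "'e::real_normed_vector \<Rightarrow> real"
  assumes S: "open S" "x \<in> S" and f: "smooth_on S f"
  shows "frechet_derivative (\<lambda>y. frechet_derivative f (at y) v) (at x) w =
    frechet_derivative (\<lambda>y. frechet_derivative f (at y) w) (at x) v" (is "?A x = ?B x")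
proof (rule ccontr)
  assume ne: "?A x \<noteq> ?B x"
  \<comment> \<open>Half of the gap: a number within \<open>e\<close> of \<open>?A x\<close> cannot
    also be within \<open>e\<close> of \<open>?B x\<close>.\<close>
  define e where "e = \<bar>?A x - ?B x\<bar> / 2"
  have e: "e > 0"
    using ne by (simp add: e_def)
  have cont: "continuous (at x) ?A" "continuous (at x) ?B"
    using smooth_on_continuous [OF smooth_on_derivative [OF smooth_on_derivative [OF f]]] S
    by (auto simp: continuous_on_eq_continuous_at)
  obtain d1 where d1: "d1 > 0" "\<And>y. dist y x < d1 \<Longrightarrow> \<bar>?A y - ?A x\<bar> < e"
    using cont(1) e unfolding continuous_at_eps_delta dist_real_def by metis
  obtain d2 where d2: "d2 > 0" "\<And>y. dist y x < d2 \<Longrightarrow> \<bar>?B y - ?B x\<bar> < e"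
    using cont(2) e unfolding continuous_at_eps_delta dist_real_def by metis
  obtain d3 where d3: "d3 > 0" "\<And>y. dist y x < d3 \<Longrightarrow> y \<in> S"
    using S by (metis open_dist)
  define d where "d = min d1 (min d2 d3)"
  \<comment> \<open>With this \<open>h\<close> the parallelogram stays within \<open>d / 2\<close>
    of \<open>x\<close>; the summand \<open>1\<close> keeps the denominator positive when both
    vectors are zero.\<close>
  define h where "h = d / (2 * (norm v + norm w + 1))"
  have d: "d > 0"
    using d1 d2 d3 by (simp add: d_def)
  have n: "norm v + norm w + 1 > 0"
    by (smt (verit) norm_ge_zero)
  have h: "h > 0"
    using d n by (simp add: h_def)
  \<comment> \<open>The condition on the norms, instead of fixed vectors, covers both orders of
    \<open>v\<close> and \<open>w\<close>.\<close>
  have near: "dist (x + s *\<^sub>R a + t *\<^sub>R b) x < d"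
    if "0 \<le> s" "s \<le> h" "0 \<le> t" "t \<le> h" "norm a + norm b = norm v + norm w" for s t a b
  proof -
    have "dist (x + s *\<^sub>R a + t *\<^sub>R b) x \<le> s * norm a + t * norm b"
      using that norm_triangle_ineq [of "s *\<^sub>R a" "t *\<^sub>R b"] by (simp add: dist_norm add.assoc)
    also have "\<dots> \<le> h * norm a + h * norm b"
      using that by (intro add_mono mult_right_mono) auto
    also have "\<dots> = h * (norm v + norm w)"
      using that(5) by (simp flip: distrib_left)
    also have "\<dots> \<le> h * (norm v + norm w + 1)"
      using h by (simp add: mult_left_mono)
    also have "\<dots> = d / 2"
      using n by (simp add: h_def field_simps)
    also have "\<dots> < d"
      using d by simp
    finally show ?thesis .
  qed
  have fd: "f differentiable (at y)" if "y \<in> S" for y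
    using f that by (rule smooth_on_differentiable)
  have fd2: "(\<lambda>y. frechet_derivative f (at y) u) differentiable (at y)" if "y \<in> S" for y u
    using smooth_on_derivative [OF f] that by (rule smooth_on_differentiable)
  have inS: "x + s *\<^sub>R a + t *\<^sub>R b \<in> S"
    if "0 \<le> s" "s \<le> h" "0 \<le> t" "t \<le> h" "norm a + norm b = norm v + norm w" for s t a b
    using near [OF that] d3(2) by (simp add: d_def)
  obtain s t where 1: "0 < s" "s < h" "0 < t" "t < h"
    "f (x + h *\<^sub>R v + h *\<^sub>R w) - f (x + h *\<^sub>R v) - f (x + h *\<^sub>R w) + f x = h * h * ?A (x + s *\<^sub>R v + t *\<^sub>R w)"
    by (rule second_difference [OF h inS fd fd2]) auto
  obtain s' t' where 2: "0 < s'" "s' < h" "0 < t'" "t' < h"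
    "f (x + h *\<^sub>R w + h *\<^sub>R v) - f (x + h *\<^sub>R w) - f (x + h *\<^sub>R v) + f x = h * h * ?B (x + s' *\<^sub>R w + t' *\<^sub>R v)"
    by (rule second_difference [where v = w and w = v, OF h inS fd fd2]) auto
  have "f (x + h *\<^sub>R w + h *\<^sub>R v) = f (x + h *\<^sub>R v + h *\<^sub>R w)"
    by (simp add: algebra_simps)
  then have "h * h * ?A (x + s *\<^sub>R v + t *\<^sub>R w) = h * h * ?B (x + s' *\<^sub>R w + t' *\<^sub>R v)"
    using 1 2 by linarith
  then have eq: "?A (x + s *\<^sub>R v + t *\<^sub>R w) = ?B (x + s' *\<^sub>R w + t' *\<^sub>R v)"
    using h by simp
  have "dist (x + s *\<^sub>R v + t *\<^sub>R w) x < d1" "dist (x + s' *\<^sub>R w + t' *\<^sub>R v) x < d2"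
    using near [of s t v w] near [of s' t' w v] 1 2 by (auto simp: d_def)
  then have "\<bar>?A (x + s *\<^sub>R v + t *\<^sub>R w) - ?A x\<bar> < e" "\<bar>?B (x + s' *\<^sub>R w + t' *\<^sub>R v) - ?B x\<bar> < e"
    using d1(2) d2(2) by blast+
  then show False
    using eq e_def by (smt (verit) field_sum_of_halves)
qed

text \<open>The mean value argument concerns real functions. Real and imaginary part are bounded
  linear and so commute with differentiation.\<close>

lemma symmetric_second_derivative:
  fixes f :: "'e::real_normed_vector \<Rightarrow> complex"
  assumes S: "open S" "x \<in> S" and f: "smooth_on S f"
  shows "frechet_derivative (\<lambda>y. frechet_derivative f (at y) v) (at x) w =
    frechet_derivative (\<lambda>y. frechet_derivative f (at y) w) (at x) v"
proof -
  have *: "L (frechet_derivative (\<lambda>y. frechet_derivative f (at y) v) (at x) w) =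
      frechet_derivative (\<lambda>y. frechet_derivative (\<lambda>y. L (f y)) (at y) v) (at x) w"
    if "bounded_linear L" for L :: "complex \<Rightarrow> real" and v w
  proof -
    have "L (frechet_derivative (\<lambda>y. frechet_derivative f (at y) v) (at x) w) =
        frechet_derivative (\<lambda>y. L (frechet_derivative f (at y) v)) (at x) w"
      using S smooth_on_differentiable [OF smooth_on_derivative [OF f]]
      by (simp add: frechet_derivative_bounded_linear_compose [OF that])
    also have "frechet_derivative (\<lambda>y. L (frechet_derivative f (at y) v)) (at x) =
        frechet_derivative (\<lambda>y. frechet_derivative (\<lambda>y. L (f y)) (at y) v) (at x)"
      using smooth_on_differentiable [OF f]
      by (intro frechet_derivative_cong_open [OF S])
        (simp add: frechet_derivative_bounded_linear_compose [OF that])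
    finally show ?thesis .
  qed
  show ?thesis
    using symmetric_second_derivative_real [OF S smooth_on_bounded_linear [OF S(1) bounded_linear_Re f], of v w]
      symmetric_second_derivative_real [OF S smooth_on_bounded_linear [OF S(1) bounded_linear_Im f], of v w]
    by (simp add: complex_eq_iff * bounded_linear_Re bounded_linear_Im)
qed

section \<open>Wirtinger derivatives and exterior derivatives\<close>

text \<open>For \<open>\<epsilon> = -\<i>\<close> and \<open>\<epsilon> = \<i>\<close> this is the derivative along the \<open>(1,0)\<close>-part and the \<open>(0,1)\<close>-part
  of the real tangent vector \<open>v\<close>.\<close>

definition wirtinger :: "complex \<Rightarrow> complex^'n::finite \<Rightarrow> (complex^'n \<Rightarrow> complex) \<Rightarrow> complex^'n \<Rightarrow> complex" where
  "wirtinger \<epsilon> v f z = (frechet_derivative f (at z) v + \<epsilon> * frechet_derivative f (at z) (\<i> *s v)) / 2"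

lemma imag_axis: "\<i> *s axis k 1 = axis k \<i>"
  by (simp add: vec_eq_iff axis_def)

lemma d_dz_eq_wirtinger: "d_dz k f z = wirtinger (- \<i>) (axis k 1) f z"
  by (simp add: d_dz_def wirtinger_def imag_axis)

lemma d_dzbar_eq_wirtinger: "d_dzbar k f z = wirtinger \<i> (axis k 1) f z"
  by (simp add: d_dzbar_def wirtinger_def imag_axis)

lemma linear_real_coordinates:
  fixes L :: "complex^'n::finite \<Rightarrow> complex"
  assumes "linear L"
  shows "L v = (\<Sum>k\<in>UNIV. of_real (Re (v $ k)) * L (axis k 1) + of_real (Im (v $ k)) * L (axis k \<i>))"
proof -
  have "v = (\<Sum>k\<in>UNIV. Re (v $ k) *\<^sub>R axis k 1 + Im (v $ k) *\<^sub>R axis k \<i>)"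
    by (simp add: vec_eq_iff axis_def if_distrib [of "\<lambda>x. _ *\<^sub>R x"] sum.distrib complex_eq_iff cong: if_cong)
  then have "L v = L (\<Sum>k\<in>UNIV. Re (v $ k) *\<^sub>R axis k 1 + Im (v $ k) *\<^sub>R axis k \<i>)"
    by simp
  also have "\<dots> = (\<Sum>k\<in>UNIV. Re (v $ k) *\<^sub>R L (axis k 1) + Im (v $ k) *\<^sub>R L (axis k \<i>))"
    using assms by (simp add: linear_sum linear_add linear_scale)
  finally show ?thesis
    by (simp add: scaleR_conv_of_real)
qed

text \<open>For a real-linear \<open>L\<close>, the map \<open>L v - \<i> * L (\<i> *s v)\<close> is
  complex linear in \<open>v\<close>, and with a plus sign it is conjugate linear. Each is therefore
  determined by its values at \<open>axis k 1\<close>.\<close>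

lemma wirtinger_coordinates:
  assumes "f differentiable (at z)"
  shows "wirtinger (- \<i>) v f z = (\<Sum>k\<in>UNIV. dz k v * d_dz k f z)"
    and "wirtinger \<i> v f z = (\<Sum>k\<in>UNIV. dzbar k v * d_dzbar k f z)"
proof -
  define L where "L = frechet_derivative f (at z)"
  have L: "linear L"
    using assms by (simp add: L_def linear_frechet_derivative)
  have c: "of_real (Re c) * a + of_real (Im c) * b - \<i> * (of_real (Re (\<i> * c)) * a + of_real (Im (\<i> * c)) * b) = c * (a - \<i> * b)"
    "of_real (Re c) * a + of_real (Im c) * b + \<i> * (of_real (Re (\<i> * c)) * a + of_real (Im (\<i> * c)) * b) = cnj c * (a + \<i> * b)"
    for a b c
    by (auto simp: complex_eq_iff algebra_simps)
  have "L v - \<i> * L (\<i> *s v) = (\<Sum>k\<in>UNIV. v $ k * (L (axis k 1) - \<i> * L (axis k \<i>)))"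
    unfolding linear_real_coordinates [OF L, of v] linear_real_coordinates [OF L, of "\<i> *s v"]
    by (simp only: sum_distrib_left flip: sum_subtractf) (simp only: vector_smult_component c)
  then show "wirtinger (- \<i>) v f z = (\<Sum>k\<in>UNIV. dz k v * d_dz k f z)"
    by (simp add: wirtinger_def d_dz_def dz_def L_def sum_divide_distrib)
  have "L v + \<i> * L (\<i> *s v) = (\<Sum>k\<in>UNIV. cnj (v $ k) * (L (axis k 1) + \<i> * L (axis k \<i>)))"
    unfolding linear_real_coordinates [OF L, of v] linear_real_coordinates [OF L, of "\<i> *s v"]
    by (simp only: sum_distrib_left flip: sum.distrib) (simp only: vector_smult_component c)
  then show "wirtinger \<i> v f z = (\<Sum>k\<in>UNIV. dzbar k v * d_dzbar k f z)"
    by (simp add: wirtinger_def d_dzbar_def dzbar_def L_def sum_divide_distrib)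
qed

lemma wirtinger_cong_open:
  assumes "open S" "z \<in> S" "\<And>w. w \<in> S \<Longrightarrow> f w = g w"
  shows "wirtinger \<epsilon> v f z = wirtinger \<epsilon> v g z"
  using frechet_derivative_cong_open [OF assms] by (simp add: wirtinger_def)

lemma wirtinger_const: "wirtinger \<epsilon> v (\<lambda>_. c) z = 0"
  by (simp add: wirtinger_def)

lemma wirtinger_add:
  assumes "f differentiable (at z)" "g differentiable (at z)"
  shows "wirtinger \<epsilon> v (\<lambda>w. f w + g w) z = wirtinger \<epsilon> v f z + wirtinger \<epsilon> v g z"
  using assms by (simp add: wirtinger_def frechet_derivative_add' algebra_simps add_divide_distrib)

lemma wirtinger_mult:
  assumes "f differentiable (at z)" "g differentiable (at z)"
  shows "wirtinger \<epsilon> v (\<lambda>w. f w * g w) z = f z * wirtinger \<epsilon> v g z + wirtinger \<epsilon> v f z * g z"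
  using assms by (simp add: wirtinger_def frechet_derivative_mult' algebra_simps add_divide_distrib)

lemma wirtinger_cmult:
  assumes "f differentiable (at z)"
  shows "wirtinger \<epsilon> v (\<lambda>w. c * f w) z = c * wirtinger \<epsilon> v f z"
  using wirtinger_mult [of "\<lambda>_. c" z f] assms by (simp add: wirtinger_const)

lemma wirtinger_diff:
  assumes "f differentiable (at z)" "g differentiable (at z)"
  shows "wirtinger \<epsilon> v (\<lambda>w. f w - g w) z = wirtinger \<epsilon> v f z - wirtinger \<epsilon> v g z"
  using wirtinger_add [of f z "\<lambda>w. (- 1) * g w"] wirtinger_cmult [of g z _ _ "- 1"] assms by simp

lemma wirtinger_sum:
  assumes "\<And>i. i \<in> A \<Longrightarrow> f i differentiable (at z)"
  shows "wirtinger \<epsilon> v (\<lambda>w. \<Sum>i\<in>A. f i w) z = (\<Sum>i\<in>A. wirtinger \<epsilon> v (f i) z)"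
  using assms
proof (induction A rule: infinite_finite_induct)
  case (insert x F)
  then have "(\<lambda>w. \<Sum>i\<in>F. f i w) differentiable (at z)"
    by (intro differentiable_sum) auto
  then show ?case
    using insert by (simp add: wirtinger_add)
qed (simp_all add: wirtinger_const)

lemma smooth_on_wirtinger:
  assumes "open S" "smooth_on S f"
  shows "smooth_on S (\<lambda>z. wirtinger \<epsilon> v f z)"
proof -
  have "smooth_on S (\<lambda>z. (1/2) * (frechet_derivative f (at z) v + \<epsilon> * frechet_derivative f (at z) (\<i> *s v)))"
    using assms by (intro smooth_on_cmult smooth_on_add smooth_on_derivative)
  then show ?thesis
    by (simp add: wirtinger_def)
qed

text \<open>Both sides expand into the same four second derivatives, along \<open>u\<close> or
  \<open>\<i> *s u\<close> and \<open>v\<close> or \<open>\<i> *s v\<close>, and each of these is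
  symmetric.\<close>

lemma wirtinger_commute:
  assumes S: "open S" "z \<in> S" and f: "smooth_on S f"
  shows "wirtinger \<epsilon> v (wirtinger \<delta> u f) z = wirtinger \<delta> u (wirtinger \<epsilon> v f) z"
proof -
  have expand: "frechet_derivative (wirtinger \<delta> u f) (at z) v =
      (frechet_derivative (\<lambda>w. frechet_derivative f (at w) u) (at z) v +
        \<delta> * frechet_derivative (\<lambda>w. frechet_derivative f (at w) (\<i> *s u)) (at z) v) / 2" for \<delta> u v
  proof -
    have d: "(\<lambda>w. frechet_derivative f (at w) x) differentiable (at z)" for x
      using smooth_on_derivative [OF f] S(2) by (rule smooth_on_differentiable)
    have "wirtinger \<delta> u f = (\<lambda>w. (1/2) * (frechet_derivative f (at w) u + \<delta> * frechet_derivative f (at w) (\<i> *s u)))"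
      by (simp add: wirtinger_def fun_eq_iff)
    then show ?thesis
      using d by (simp only:, subst frechet_derivative_cmult) (auto simp: frechet_derivative_cmult frechet_derivative_add')
  qed
  note sym = symmetric_second_derivative [OF S f]
  show ?thesis
    unfolding wirtinger_def [of \<epsilon> v "wirtinger \<delta> u f"] wirtinger_def [of \<delta> u "wirtinger \<epsilon> v f"] expand
    using sym [of u v] sym [of u "\<i> *s v"] sym [of "\<i> *s u" v] sym [of "\<i> *s u" "\<i> *s v"]
    by (simp add: field_simps)
qed

text \<open>The coordinate-free form of \<open>\<partial>\<close> (for \<open>\<epsilon> = -\<i>\<close>) and of its conjugate (for \<open>\<epsilon> = \<i>\<close>).\<close>

definition ext_deriv :: "complex \<Rightarrow> (complex^'n::finite \<Rightarrow> 'n covector) \<Rightarrow> complex^'n \<Rightarrow> 'n covector" where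
  "ext_deriv \<epsilon> \<omega> z vs =
    (\<Sum>i<length vs. (-1) ^ i * wirtinger \<epsilon> (vs ! i) (\<lambda>w. \<omega> w (take i vs @ drop (Suc i) vs)) z)"

lemma ext_deriv_Nil [simp]: "ext_deriv \<epsilon> \<omega> z [] = 0"
  by (simp add: ext_deriv_def)

text \<open>The recursion behind the inductions on argument lists: the remainder is the derivative
  of the form contracted with \<open>v\<close>. No bracket terms occur because the arguments are
  constant vector fields.\<close>

lemma ext_deriv_Cons [simp]:
  "ext_deriv \<epsilon> \<omega> z (v # vs) = wirtinger \<epsilon> v (\<lambda>w. \<omega> w vs) z - ext_deriv \<epsilon> (\<lambda>w us. \<omega> w (v # us)) z vs"
  by (simp add: ext_deriv_def sum.lessThan_Suc_shift sum_negf [symmetric] del: sum.lessThan_Suc)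

text \<open>Interchanging the sum over coordinates with the sum over argument positions leaves, in
  each position, the coordinate expansion of the derivative along the (1,0)-part of that
  argument.\<close>

lemma local_del_eq_ext_deriv:
  assumes "\<And>us. (\<lambda>w. \<omega> w us) differentiable (at z)"
  shows "local_del \<omega> z vs = ext_deriv (- \<i>) \<omega> z vs"
proof -
  have "local_del \<omega> z vs = (\<Sum>i<length vs. \<Sum>k\<in>UNIV. (-1) ^ i * dz k (vs ! i) * d_dz k (\<lambda>w. \<omega> w (take i vs @ drop (Suc i) vs)) z)"
    unfolding local_del_def wedge1_def by (rule sum.swap)
  also have "\<dots> = ext_deriv (- \<i>) \<omega> z vs"
    unfolding ext_deriv_def wirtinger_coordinates(1) [OF assms] by (simp add: sum_distrib_left mult.assoc)
  finally show ?thesis .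
qed

lemma local_delbar_eq_ext_deriv:
  assumes "\<And>us. (\<lambda>w. \<omega> w us) differentiable (at z)"
  shows "local_delbar \<omega> z vs = ext_deriv \<i> \<omega> z vs"
proof -
  have "local_delbar \<omega> z vs = (\<Sum>i<length vs. \<Sum>k\<in>UNIV. (-1) ^ i * dzbar k (vs ! i) * d_dzbar k (\<lambda>w. \<omega> w (take i vs @ drop (Suc i) vs)) z)"
    unfolding local_delbar_def wedge1_def by (rule sum.swap)
  also have "\<dots> = ext_deriv \<i> \<omega> z vs"
    unfolding ext_deriv_def wirtinger_coordinates(2) [OF assms] by (simp add: sum_distrib_left mult.assoc)
  finally show ?thesis .
qed

lemma ext_deriv_cong_open:
  assumes "open S" "z \<in> S" "\<And>w us. w \<in> S \<Longrightarrow> \<omega> w us = \<eta> w us"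
  shows "ext_deriv \<epsilon> \<omega> z vs = ext_deriv \<epsilon> \<eta> z vs"
  unfolding ext_deriv_def using assms by (intro sum.cong refl arg_cong2 [of _ _ _ _ "(*)"] wirtinger_cong_open) auto

lemma ext_deriv_add:
  assumes "\<And>us. (\<lambda>w. \<omega> w us) differentiable (at z)" "\<And>us. (\<lambda>w. \<eta> w us) differentiable (at z)"
  shows "ext_deriv \<epsilon> (\<lambda>w us. \<omega> w us + \<eta> w us) z vs = ext_deriv \<epsilon> \<omega> z vs + ext_deriv \<epsilon> \<eta> z vs"
  using assms by (simp add: ext_deriv_def wirtinger_add distrib_left sum.distrib)

lemma ext_deriv_diff:
  assumes "\<And>us. (\<lambda>w. \<omega> w us) differentiable (at z)" "\<And>us. (\<lambda>w. \<eta> w us) differentiable (at z)"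
  shows "ext_deriv \<epsilon> (\<lambda>w us. \<omega> w us - \<eta> w us) z vs = ext_deriv \<epsilon> \<omega> z vs - ext_deriv \<epsilon> \<eta> z vs"
  using assms by (simp add: ext_deriv_def wirtinger_diff right_diff_distrib sum_subtractf)

lemma ext_deriv_sum:
  assumes "\<And>i us. i \<in> A \<Longrightarrow> (\<lambda>w. \<omega> i w us) differentiable (at z)"
  shows "ext_deriv \<epsilon> (\<lambda>w us. \<Sum>i\<in>A. \<omega> i w us) z vs = (\<Sum>i\<in>A. ext_deriv \<epsilon> (\<omega> i) z vs)"
proof -
  have "ext_deriv \<epsilon> (\<lambda>w us. \<Sum>i\<in>A. \<omega> i w us) z vs =
      (\<Sum>j<length vs. \<Sum>i\<in>A. (-1) ^ j * wirtinger \<epsilon> (vs ! j) (\<lambda>w. \<omega> i w (take j vs @ drop (Suc j) vs)) z)"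
    using assms by (simp add: ext_deriv_def wirtinger_sum sum_distrib_left)
  also have "\<dots> = (\<Sum>i\<in>A. ext_deriv \<epsilon> (\<omega> i) z vs)"
    unfolding ext_deriv_def by (rule sum.swap)
  finally show ?thesis .
qed

lemma ext_deriv_scale:
  assumes "f differentiable (at z)" "\<And>us. (\<lambda>w. \<omega> w us) differentiable (at z)"
  shows "ext_deriv \<epsilon> (\<lambda>w us. f w * \<omega> w us) z vs =
    wedge1 (\<lambda>v. wirtinger \<epsilon> v f z) (\<omega> z) vs + f z * ext_deriv \<epsilon> \<omega> z vs"
  using assms by (simp add: ext_deriv_def wedge1_def wirtinger_mult distrib_left sum.distrib sum_distrib_left mult_ac)

lemma ext_deriv_const: "ext_deriv \<epsilon> (\<lambda>_. \<alpha>) z vs = 0"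
  by (simp add: ext_deriv_def wirtinger_const)

lemma ext_deriv_cmult:
  assumes "\<And>us. (\<lambda>w. \<omega> w us) differentiable (at z)"
  shows "ext_deriv \<epsilon> (\<lambda>w us. c * \<omega> w us) z vs = c * ext_deriv \<epsilon> \<omega> z vs"
  using assms by (simp add: ext_deriv_def wirtinger_cmult sum_distrib_left mult_ac)

lemma smooth_on_ext_deriv:
  assumes "open S" "\<And>us. smooth_on S (\<lambda>w. \<omega> w us)"
  shows "smooth_on S (\<lambda>w. ext_deriv \<epsilon> \<omega> w vs)"
  unfolding ext_deriv_def using assms by (intro smooth_on_sum smooth_on_cmult smooth_on_wirtinger)

lemma wirtinger_ext_deriv:
  assumes S: "open S" "z \<in> S" and \<omega>: "\<And>us. smooth_on S (\<lambda>w. \<omega> w us)"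
  shows "wirtinger \<epsilon> v (\<lambda>w. ext_deriv \<delta> \<omega> w vs) z = ext_deriv \<delta> (\<lambda>w us. wirtinger \<epsilon> v (\<lambda>x. \<omega> x us) w) z vs"
proof -
  have d: "(\<lambda>w. wirtinger \<delta> u (\<lambda>w. \<omega> w us) w) differentiable (at z)" for u us
    using smooth_on_wirtinger [OF S(1) \<omega>] S(2) by (rule smooth_on_differentiable)
  have "wirtinger \<epsilon> v (\<lambda>w. ext_deriv \<delta> \<omega> w vs) z =
      (\<Sum>i<length vs. (-1) ^ i * wirtinger \<epsilon> v (\<lambda>w. wirtinger \<delta> (vs ! i) (\<lambda>w. \<omega> w (take i vs @ drop (Suc i) vs)) w) z)"
    unfolding ext_deriv_def using d by (simp add: wirtinger_sum wirtinger_cmult differentiable_mult)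
  then show ?thesis
    using wirtinger_commute [OF S \<omega>, of \<epsilon> v \<delta>] by (simp add: ext_deriv_def)
qed

text \<open>In \<open>step\<close> the first two terms change sign when \<epsilon> and \<delta> are
  exchanged, and the third is the induction hypothesis for the form contracted with
  \<open>v\<close>. Equal parameters give vanishing squares; the parameters \<open>-\<i>\<close> and
  \<open>\<i>\<close> give anticommutation of \<partial> and \<partial>bar.\<close>

lemma ext_deriv_anticommute:
  assumes S: "open S" "z \<in> S" and \<omega>: "\<And>us. smooth_on S (\<lambda>w. \<omega> w us)"
  shows "ext_deriv \<epsilon> (ext_deriv \<delta> \<omega>) z vs = - ext_deriv \<delta> (ext_deriv \<epsilon> \<omega>) z vs"
  using \<omega>
proof (induction vs arbitrary: \<omega>)
  case (Cons v vs)
  have step: "ext_deriv \<epsilon> (ext_deriv \<delta> \<omega>) z (v # vs) =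
      ext_deriv \<delta> (\<lambda>w us. wirtinger \<epsilon> v (\<lambda>x. \<omega> x us) w) z vs
      - ext_deriv \<epsilon> (\<lambda>w us. wirtinger \<delta> v (\<lambda>x. \<omega> x us) w) z vs
      + ext_deriv \<epsilon> (ext_deriv \<delta> (\<lambda>w us. \<omega> w (v # us))) z vs" for \<epsilon> \<delta>
  proof -
    have "(\<lambda>w. wirtinger \<delta> v (\<lambda>w. \<omega> w us) w) differentiable (at z)" for us
      using smooth_on_wirtinger [OF S(1) Cons.prems] S(2) by (rule smooth_on_differentiable)
    moreover have "(\<lambda>w. ext_deriv \<delta> (\<lambda>w us. \<omega> w (v # us)) w us) differentiable (at z)" for us
      using smooth_on_ext_deriv [OF S(1) Cons.prems] S(2) by (rule smooth_on_differentiable)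
    ultimately show ?thesis
      by (simp add: wirtinger_ext_deriv [OF S Cons.prems] ext_deriv_diff)
  qed
  show ?case
    unfolding step using Cons.IH [of "\<lambda>w us. \<omega> w (v # us)"] Cons.prems by simp
qed simp

text \<open>The symmetry hypothesis says that the 1-form \<open>\<beta>\<close> is closed.\<close>

lemma ext_deriv_wedge1:
  assumes \<beta>: "\<And>u. (\<lambda>w. \<beta> w u) differentiable (at z)" and \<alpha>: "\<And>us. (\<lambda>w. \<alpha> w us) differentiable (at z)"
    and closed: "\<And>u v. wirtinger \<epsilon> v (\<lambda>w. \<beta> w u) z = wirtinger \<epsilon> u (\<lambda>w. \<beta> w v) z"
  shows "ext_deriv \<epsilon> (\<lambda>w. wedge1 (\<beta> w) (\<alpha> w)) z vs = - wedge1 (\<beta> z) (ext_deriv \<epsilon> \<alpha> z) vs"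
  using \<alpha>
proof (induction vs arbitrary: \<alpha>)
  case (Cons v vs)
  have d: "(\<lambda>w. wedge1 (\<beta> w) (\<alpha> w) us) differentiable (at z)"
    if "\<And>us. (\<lambda>w. \<alpha> w us) differentiable (at z)" for \<alpha> us
    unfolding wedge1_def using that \<beta> by (intro differentiable_sum differentiable_mult) auto
  have 1: "wirtinger \<epsilon> v (\<lambda>w. wedge1 (\<beta> w) (\<alpha> w) vs) z =
      wedge1 (\<lambda>u. wirtinger \<epsilon> v (\<lambda>w. \<beta> w u) z) (\<alpha> z) vs + wedge1 (\<beta> z) (\<lambda>us. wirtinger \<epsilon> v (\<lambda>w. \<alpha> w us) z) vs"
    unfolding wedge1_def using \<beta> Cons.prems
    by (simp add: wirtinger_sum wirtinger_mult wirtinger_const differentiable_mult algebra_simps sum.distrib)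
  have 2: "ext_deriv \<epsilon> (\<lambda>w us. \<beta> w v * \<alpha> w us) z vs =
      wedge1 (\<lambda>u. wirtinger \<epsilon> u (\<lambda>w. \<beta> w v) z) (\<alpha> z) vs + \<beta> z v * ext_deriv \<epsilon> \<alpha> z vs"
    using \<beta> Cons.prems by (rule ext_deriv_scale)
  have 3: "ext_deriv \<epsilon> (\<lambda>w us. \<beta> w v * \<alpha> w us - wedge1 (\<beta> w) (\<lambda>us. \<alpha> w (v # us)) us) z vs =
      ext_deriv \<epsilon> (\<lambda>w us. \<beta> w v * \<alpha> w us) z vs + wedge1 (\<beta> z) (ext_deriv \<epsilon> (\<lambda>w us. \<alpha> w (v # us)) z) vs"
    using Cons.IH [of "\<lambda>w us. \<alpha> w (v # us)"] \<beta> Cons.prems d [of "\<lambda>w us. \<alpha> w (v # us)"]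
    by (simp add: ext_deriv_diff differentiable_mult)
  \<comment> \<open>By closedness the terms of \<open>1\<close> and \<open>2\<close> in which
    \<beta> is differentiated agree; they enter with opposite signs and cancel.\<close>
  have "(\<lambda>u. wirtinger \<epsilon> u (\<lambda>w. \<beta> w v) z) = (\<lambda>u. wirtinger \<epsilon> v (\<lambda>w. \<beta> w u) z)"
    using closed by blast
  then show ?case
    by (simp add: 1 2 3 wedge1_diff)
qed simp

lemma differentiable_wedge:
  assumes "\<And>\<beta> u. \<beta> \<in> set \<beta>s \<Longrightarrow> (\<lambda>w. \<beta> w u) differentiable (at z)"
  shows "(\<lambda>w. wedge (map (\<lambda>\<beta>. \<beta> w) \<beta>s) vs) differentiable (at z)"
  using assms
proof (induction \<beta>s arbitrary: vs)
  case (Cons \<beta> \<beta>s)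
  then show ?case
    by (auto simp: wedge1_def intro!: differentiable_sum differentiable_mult)
qed simp

lemma ext_deriv_wedge_closed:
  assumes "\<And>\<beta> u. \<beta> \<in> set \<beta>s \<Longrightarrow> (\<lambda>w. \<beta> w u) differentiable (at z)"
    and "\<And>\<beta> u v. \<beta> \<in> set \<beta>s \<Longrightarrow> wirtinger \<epsilon> v (\<lambda>w. \<beta> w u) z = wirtinger \<epsilon> u (\<lambda>w. \<beta> w v) z"
  shows "ext_deriv \<epsilon> (\<lambda>w. wedge (map (\<lambda>\<beta>. \<beta> w) \<beta>s)) z vs = 0"
  using assms
proof (induction \<beta>s arbitrary: vs)
  case Nil
  then show ?case
    by (simp add: ext_deriv_def wirtinger_const)
next
  case (Cons \<beta> \<beta>s)
  have "ext_deriv \<epsilon> (\<lambda>w. wedge1 (\<beta> w) (wedge (map (\<lambda>\<beta>. \<beta> w) \<beta>s))) z vs =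
      - wedge1 (\<beta> z) (ext_deriv \<epsilon> (\<lambda>w. wedge (map (\<lambda>\<beta>. \<beta> w) \<beta>s)) z) vs"
    using Cons.prems by (intro ext_deriv_wedge1 differentiable_wedge) auto
  also have "ext_deriv \<epsilon> (\<lambda>w. wedge (map (\<lambda>\<beta>. \<beta> w) \<beta>s)) z = (\<lambda>_. 0)"
    using Cons by auto
  finally show ?case
    by (simp add: wedge1_def)
qed

text \<open>In the Leibniz rule only the coefficient is differentiated, since a wedge of closed
  1-forms is closed. Each term of a pulled-back form has this shape.\<close>

lemma ext_deriv_scale_wedge:
  assumes "f differentiable (at z)"
    and "\<And>\<beta> u. \<beta> \<in> set \<beta>s \<Longrightarrow> (\<lambda>w. \<beta> w u) differentiable (at z)"
    and "\<And>\<beta> u v. \<beta> \<in> set \<beta>s \<Longrightarrow> wirtinger \<epsilon> v (\<lambda>w. \<beta> w u) z = wirtinger \<epsilon> u (\<lambda>w. \<beta> w v) z"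
  shows "ext_deriv \<epsilon> (\<lambda>w us. f w * wedge (map (\<lambda>\<beta>. \<beta> w) \<beta>s) us) z vs =
    wedge ((\<lambda>v. wirtinger \<epsilon> v f z) # map (\<lambda>\<beta>. \<beta> z) \<beta>s) vs"
proof -
  have "(\<lambda>w. wedge (map (\<lambda>\<beta>. \<beta> w) \<beta>s) us) differentiable (at z)" for us
    using assms(2) by (rule differentiable_wedge)
  moreover have "ext_deriv \<epsilon> (\<lambda>w. wedge (map (\<lambda>\<beta>. \<beta> w) \<beta>s)) z vs = 0"
    using assms(2,3) by (rule ext_deriv_wedge_closed)
  ultimately show ?thesis
    using assms(1) by (simp add: ext_deriv_scale)
qed

section \<open>Pullback along holomorphic maps\<close>

lemma wedge1_map: "wedge1 \<beta> \<alpha> (map L vs) = wedge1 (\<lambda>v. \<beta> (L v)) (\<lambda>us. \<alpha> (map L us)) vs"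
  by (simp add: wedge1_def take_map drop_map)

lemma wedge_map: "wedge \<beta>s (map L vs) = wedge (map (\<lambda>\<beta> v. \<beta> (L v)) \<beta>s) vs"
  by (induction \<beta>s arbitrary: vs) (simp_all add: wedge1_map)

lemma wedge1_sum: "wedge1 \<beta> (\<lambda>us. \<Sum>i\<in>A. f i us) vs = (\<Sum>i\<in>A. wedge1 \<beta> (f i) vs)"
  unfolding wedge1_def sum_distrib_left by (rule sum.swap)

text \<open>Needed for \<partial>bar, which puts \<open>dzbar k\<close> in front of the
  \<open>dz\<close> factors, while forms are written with all \<open>dz\<close> first.\<close>

lemma wedge_move: "wedge (\<beta> # \<beta>s @ \<gamma>s) vs = (-1) ^ length \<beta>s * wedge (\<beta>s @ \<beta> # \<gamma>s) vs"
proof (induction \<beta>s arbitrary: vs)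
  case (Cons \<alpha> \<beta>s)
  have "wedge (\<beta> # (\<alpha> # \<beta>s) @ \<gamma>s) vs = - wedge1 \<alpha> (wedge (\<beta> # \<beta>s @ \<gamma>s)) vs"
    using wedge1_anticommute [of \<beta> \<alpha> "wedge (\<beta>s @ \<gamma>s)" vs] by simp
  also have "wedge (\<beta> # \<beta>s @ \<gamma>s) = (\<lambda>vs. (-1) ^ length \<beta>s * wedge (\<beta>s @ \<beta> # \<gamma>s) vs)"
    using Cons.IH by blast
  finally show ?case
    by (simp add: wedge1_scale)
qed simp

lemma holomorphic_map_on_differentiable:
  fixes T :: "complex^'n::finite \<Rightarrow> complex^'m::finite"
  assumes T: "holomorphic_map_on S T" and z: "z \<in> S"
  shows "T differentiable (at z)"
proof -
  have "(\<lambda>z. T z $ i) differentiable (at z)" for i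
    using T z smooth_on_differentiable unfolding holomorphic_map_on_def by blast
  then obtain D where D: "((\<lambda>z. T z $ i) has_derivative D i) (at z)" for i
    unfolding differentiable_def by metis
  have "bounded_linear (axis i :: complex \<Rightarrow> complex^'m)" for i
    unfolding linear_conv_bounded_linear [symmetric] by (intro linearI) (simp_all add: vec_eq_iff axis_def)
  then have "((\<lambda>z. \<Sum>i\<in>UNIV. axis i (T z $ i)) has_derivative (\<lambda>h. \<Sum>i\<in>UNIV. axis i (D i h))) (at z)"
    by (intro has_derivative_sum bounded_linear.has_derivative [OF _ D])
  moreover have "(\<lambda>z. \<Sum>i\<in>UNIV. axis i (T z $ i)) = T"
    by (simp add: fun_eq_iff vec_eq_iff axis_def)
  ultimately show ?thesis
    unfolding differentiable_def by auto
qed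

lemma frechet_derivative_component:
  fixes T :: "complex^'n::finite \<Rightarrow> complex^'m::finite"
  assumes "T differentiable (at z)"
  shows "frechet_derivative T (at z) v $ i = frechet_derivative (\<lambda>z. T z $ i) (at z) v"
  by (rule frechet_derivative_bounded_linear_compose [OF bounded_linear_vec_nth assms, symmetric])

text \<open>The Cauchy-Riemann equations concern the coordinate directions. By
  \<open>wirtinger_coordinates\<close> they make the (0,1)-derivative vanish along every real
  vector, which is complex linearity of the differential.\<close>

lemma holomorphic_map_on_complex_linear:
  fixes T :: "complex^'n::finite \<Rightarrow> complex^'m::finite"
  assumes T: "holomorphic_map_on S T" and z: "z \<in> S"
  shows "frechet_derivative (\<lambda>z. T z $ i) (at z) (\<i> *s v) = \<i> * frechet_derivative (\<lambda>z. T z $ i) (at z) v"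
    (is "?L (\<i> *s v) = \<i> * ?L v")
proof -
  have "(\<lambda>z. T z $ i) differentiable (at z)"
    using T z smooth_on_differentiable unfolding holomorphic_map_on_def by blast
  then have "wirtinger \<i> v (\<lambda>z. T z $ i) z = 0"
    using T z by (simp add: wirtinger_coordinates(2) holomorphic_map_on_def)
  then have "\<i> * (?L v + \<i> * ?L (\<i> *s v)) = 0"
    by (simp add: wirtinger_def)
  then show ?thesis
    by (simp add: algebra_simps)
qed

lemma frechet_derivative_holomorphic_map_imag:
  fixes T :: "complex^'n::finite \<Rightarrow> complex^'m::finite"
  assumes "holomorphic_map_on S T" "z \<in> S"
  shows "frechet_derivative T (at z) (\<i> *s v) = \<i> *s frechet_derivative T (at z) v"
  using holomorphic_map_on_complex_linear [OF assms]
  by (simp add: vec_eq_iff frechet_derivative_component [OF holomorphic_map_on_differentiable [OF assms]])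

text \<open>The chain rule carries the pair \<open>v\<close>, \<open>\<i> *s v\<close> to a pair of
  the same kind because the differential of \<open>T\<close> commutes with \<open>\<i>\<close>.
  Hence types are preserved, for every \<epsilon>.\<close>

lemma wirtinger_compose_holomorphic_map:
  fixes T :: "complex^'n::finite \<Rightarrow> complex^'m::finite"
  assumes T: "holomorphic_map_on S T" "z \<in> S" and f: "f differentiable (at (T z))"
  shows "(\<lambda>w. f (T w)) differentiable (at z)"
    and "wirtinger \<epsilon> v (\<lambda>w. f (T w)) z = wirtinger \<epsilon> (frechet_derivative T (at z) v) f (T z)"
proof -
  have "((f \<circ> T) has_derivative frechet_derivative f (at (T z)) \<circ> frechet_derivative T (at z)) (at z)"
    using f holomorphic_map_on_differentiable [OF T] by (intro diff_chain_at) (auto simp: frechet_derivative_works)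
  then have D: "((\<lambda>w. f (T w)) has_derivative (\<lambda>v. frechet_derivative f (at (T z)) (frechet_derivative T (at z) v))) (at z)"
    by (simp add: o_def)
  then show "(\<lambda>w. f (T w)) differentiable (at z)"
    unfolding differentiable_def by blast
  show "wirtinger \<epsilon> v (\<lambda>w. f (T w)) z = wirtinger \<epsilon> (frechet_derivative T (at z) v) f (T z)"
    unfolding wirtinger_def frechet_derivative_at [OF D, symmetric]
      frechet_derivative_holomorphic_map_imag [OF T] ..
qed

text \<open>The differential is complex linear on a whole open set, so differentiating it gives
  compatibility with \<open>\<i>\<close> in the first argument of \<open>B\<close>. Symmetry
  transfers this to the second one, in which \<open>wirtinger\<close> differentiates.\<close>

lemma second_derivative_holomorphic_map:
  fixes T :: "complex^'n::finite \<Rightarrow> complex^'m::finite" and i :: 'm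
  assumes S: "open S" "z \<in> S" and T: "holomorphic_map_on S T"
  defines "B \<equiv> \<lambda>u v. frechet_derivative (\<lambda>w. frechet_derivative T (at w) u $ i) (at z) v"
  shows "(\<lambda>w. frechet_derivative T (at w) u $ i) differentiable (at z)"
    and "B u v = B v u" and "B u (\<i> *s v) = \<i> * B u v"
proof -
  have Ti: "smooth_on S (\<lambda>z. T z $ i)"
    using T by (simp add: holomorphic_map_on_def)
  have eq: "frechet_derivative (\<lambda>z. T z $ i) (at w) u = frechet_derivative T (at w) u $ i" if "w \<in> S" for w u
    by (rule frechet_derivative_component [OF holomorphic_map_on_differentiable [OF T that], symmetric])
  have diff: "(\<lambda>w. frechet_derivative (\<lambda>z. T z $ i) (at w) u) differentiable (at z)" for u
    using smooth_on_derivative [OF Ti] S(2) by (rule smooth_on_differentiable)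
  show "(\<lambda>w. frechet_derivative T (at w) u $ i) differentiable (at z)"
    by (rule differentiable_cong_open [OF S eq diff])
  have B: "B u v = frechet_derivative (\<lambda>w. frechet_derivative (\<lambda>z. T z $ i) (at w) u) (at z) v" for u v
    unfolding B_def by (rule fun_cong [OF frechet_derivative_cong_open [OF S eq [symmetric]]])
  have sym: "B u v = B v u" for u v
    unfolding B by (rule symmetric_second_derivative [OF S Ti])
  show "B u v = B v u"
    by (rule sym)
  have "B (\<i> *s v) u = frechet_derivative (\<lambda>w. \<i> * frechet_derivative (\<lambda>z. T z $ i) (at w) v) (at z) u"
    unfolding B
    by (rule fun_cong [OF frechet_derivative_cong_open [OF S holomorphic_map_on_complex_linear [OF T]]])
  also have "\<dots> = \<i> * B v u"
    unfolding B by (rule frechet_derivative_cmult [OF diff])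
  finally show "B u (\<i> *s v) = \<i> * B u v"
    using sym by metis
qed

text \<open>Both sides equal \<open>(1 + \<epsilon> * \<i>) / 2\<close> times the second derivative
  \<open>B u v\<close>, which is symmetric.\<close>

lemma pullback_dz_closed:
  fixes T :: "complex^'n::finite \<Rightarrow> complex^'m::finite"
  assumes S: "open S" "z \<in> S" and T: "holomorphic_map_on S T"
  shows "(\<lambda>w. dz i (frechet_derivative T (at w) u)) differentiable (at z)"
    and "wirtinger \<epsilon> v (\<lambda>w. dz i (frechet_derivative T (at w) u)) z =
      wirtinger \<epsilon> u (\<lambda>w. dz i (frechet_derivative T (at w) v)) z"
proof -
  note D = second_derivative_holomorphic_map [OF S T]
  show "(\<lambda>w. dz i (frechet_derivative T (at w) u)) differentiable (at z)"
    unfolding dz_def by (rule D(1))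
  show "wirtinger \<epsilon> v (\<lambda>w. dz i (frechet_derivative T (at w) u)) z =
      wirtinger \<epsilon> u (\<lambda>w. dz i (frechet_derivative T (at w) v)) z"
    unfolding wirtinger_def dz_def D(3) D(2) [where u = u and v = v] ..
qed

text \<open>Conjugation changes the factor to \<open>(1 - \<epsilon> * \<i>) / 2\<close> and
  \<open>B u v\<close> to its conjugate; symmetry again decides.\<close>

lemma pullback_dzbar_closed:
  fixes T :: "complex^'n::finite \<Rightarrow> complex^'m::finite"
  assumes S: "open S" "z \<in> S" and T: "holomorphic_map_on S T"
  shows "(\<lambda>w. dzbar i (frechet_derivative T (at w) u)) differentiable (at z)"
    and "wirtinger \<epsilon> v (\<lambda>w. dzbar i (frechet_derivative T (at w) u)) z =
      wirtinger \<epsilon> u (\<lambda>w. dzbar i (frechet_derivative T (at w) v)) z"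
proof -
  note D = second_derivative_holomorphic_map [OF S T]
  show "(\<lambda>w. dzbar i (frechet_derivative T (at w) u)) differentiable (at z)"
    using D(1) bounded_linear.has_derivative [OF bounded_linear_cnj] unfolding dzbar_def differentiable_def by blast
  show "wirtinger \<epsilon> v (\<lambda>w. dzbar i (frechet_derivative T (at w) u)) z =
      wirtinger \<epsilon> u (\<lambda>w. dzbar i (frechet_derivative T (at w) v)) z"
    unfolding wirtinger_def dzbar_def frechet_derivative_bounded_linear_compose [OF bounded_linear_cnj D(1)]
      D(3) D(2) [where u = u and v = v] ..
qed

section \<open>Coefficient expansions of local forms\<close>

lemma finite_lists_length [simp]: "finite {I :: 'n::finite list. length I = p}"
  using finite_lists_length_eq [of "UNIV :: 'n set" p] by simp

lemma local_pq_formE: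
  assumes "local_pq_form S p q \<omega>"
  obtains a where "\<forall>I J. smooth_on S (a I J)"
    and "\<forall>z\<in>S. \<forall>vs. \<omega> z vs = (\<Sum>I | length I = p. \<Sum>J | length J = q. a I J z * wedge (map dz I @ map dzbar J) vs)"
  using assms unfolding local_pq_form_def by (elim exE conjE)

lemma local_pq_formI:
  assumes "\<And>I J. smooth_on S (a I J)"
    and "\<And>z vs. z \<in> S \<Longrightarrow> \<omega> z vs = (\<Sum>I | length I = p. \<Sum>J | length J = q. a I J z * wedge (map dz I @ map dzbar J) vs)"
  shows "local_pq_form S p q \<omega>"
  unfolding local_pq_form_def by (rule exI [of _ a]) (use assms in simp)

text \<open>Pulling back composes the coefficients with \<open>T\<close> and turns each
  \<open>dz i\<close> and \<open>dzbar j\<close> into a closed 1-form. On both sides only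
  coefficients are then differentiated, and the chain rule for \<open>wirtinger\<close> matches the
  results.\<close>

lemma ext_deriv_pullback:
  fixes T :: "complex^'n::finite \<Rightarrow> complex^'n"
  assumes S: "open S" "z \<in> S" and T: "holomorphic_map_on S T" and S': "open S'" "T ` S \<subseteq> S'"
    and \<eta>: "local_pq_form S' p q \<eta>"
    and pull: "\<And>w us. w \<in> S \<Longrightarrow> \<omega> w us = \<eta> (T w) (map (frechet_derivative T (at w)) us)"
  shows "ext_deriv \<epsilon> \<omega> z vs = ext_deriv \<epsilon> \<eta> (T z) (map (frechet_derivative T (at z)) vs)"
proof -
  obtain a where a': "\<forall>I J. smooth_on S' (a I J)"
    "\<forall>z\<in>S'. \<forall>vs. \<eta> z vs = (\<Sum>I | length I = p. \<Sum>J | length J = q. a I J z * wedge (map dz I @ map dzbar J) vs)"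
    using \<eta> by (rule local_pq_formE)
  note a = a'(1) [rule_format] and \<eta>_eq = a'(2) [rule_format]
  have Tz: "T z \<in> S'"
    using S S' by blast
  define P where "P I J = map (\<lambda>i w v. dz i (frechet_derivative T (at w) v)) I @
    map (\<lambda>j w v. dzbar j (frechet_derivative T (at w) v)) J" for I J
  have P: "map (\<lambda>\<beta> v. \<beta> (frechet_derivative T (at w) v)) (map dz I @ map dzbar J) = map (\<lambda>\<beta>. \<beta> w) (P I J)" for w I J
    by (simp add: P_def)
  have Pdiff: "(\<lambda>w. \<beta> w u) differentiable (at z)" if "\<beta> \<in> set (P I J)" for \<beta> u I J
    using that pullback_dz_closed(1) [OF S T] pullback_dzbar_closed(1) [OF S T] by (auto simp: P_def)
  have Pclosed: "wirtinger \<epsilon> v (\<lambda>w. \<beta> w u) z = wirtinger \<epsilon> u (\<lambda>w. \<beta> w v) z" if "\<beta> \<in> set (P I J)" for \<beta> u v I J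
    using that pullback_dz_closed(2) [OF S T] pullback_dzbar_closed(2) [OF S T] by (auto simp: P_def)
  have Wdiff: "(\<lambda>w. wedge (map (\<lambda>\<beta>. \<beta> w) (P I J)) us) differentiable (at z)" for I J us
    using Pdiff by (rule differentiable_wedge)
  have adiff: "a I J differentiable (at (T z))" for I J
    using a Tz by (rule smooth_on_differentiable)
  note aT = wirtinger_compose_holomorphic_map [OF T S(2) adiff]
  have "ext_deriv \<epsilon> \<omega> z vs =
      ext_deriv \<epsilon> (\<lambda>w us. \<Sum>I | length I = p. \<Sum>J | length J = q. a I J (T w) * wedge (map (\<lambda>\<beta>. \<beta> w) (P I J)) us) z vs"
  proof (rule ext_deriv_cong_open [OF S])
    fix w us assume w: "w \<in> S"
    then have "T w \<in> S'"
      using S'(2) by blast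
    with w show "\<omega> w us = (\<Sum>I | length I = p. \<Sum>J | length J = q. a I J (T w) * wedge (map (\<lambda>\<beta>. \<beta> w) (P I J)) us)"
      by (simp only: pull \<eta>_eq wedge_map P)
  qed
  also have "\<dots> = (\<Sum>I | length I = p. \<Sum>J | length J = q.
      ext_deriv \<epsilon> (\<lambda>w us. a I J (T w) * wedge (map (\<lambda>\<beta>. \<beta> w) (P I J)) us) z vs)"
    using aT(1) Wdiff by (simp add: ext_deriv_sum differentiable_sum differentiable_mult)
  also have "\<dots> = (\<Sum>I | length I = p. \<Sum>J | length J = q.
      wedge ((\<lambda>v. wirtinger \<epsilon> v (a I J) (T z)) # map dz I @ map dzbar J) (map (frechet_derivative T (at z)) vs))"
  proof (intro sum.cong refl)
    fix I J
    have "ext_deriv \<epsilon> (\<lambda>w us. a I J (T w) * wedge (map (\<lambda>\<beta>. \<beta> w) (P I J)) us) z vs =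
        wedge ((\<lambda>v. wirtinger \<epsilon> v (\<lambda>w. a I J (T w)) z) # map (\<lambda>\<beta>. \<beta> z) (P I J)) vs"
      using aT(1) Pdiff Pclosed by (rule ext_deriv_scale_wedge)
    then show "ext_deriv \<epsilon> (\<lambda>w us. a I J (T w) * wedge (map (\<lambda>\<beta>. \<beta> w) (P I J)) us) z vs =
        wedge ((\<lambda>v. wirtinger \<epsilon> v (a I J) (T z)) # map dz I @ map dzbar J) (map (frechet_derivative T (at z)) vs)"
      by (simp only: wedge_map list.map(2) P aT(2))
  qed
  \<comment> \<open>Back in the target chart the coordinate covectors are constant, so the same
    Leibniz formula holds there.\<close>
  also have "\<dots> = (\<Sum>I | length I = p. \<Sum>J | length J = q.
      ext_deriv \<epsilon> (\<lambda>w us. a I J w * wedge (map dz I @ map dzbar J) us) (T z) (map (frechet_derivative T (at z)) vs))"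
  proof (intro sum.cong refl)
    fix I J
    show "wedge ((\<lambda>v. wirtinger \<epsilon> v (a I J) (T z)) # map dz I @ map dzbar J) (map (frechet_derivative T (at z)) vs) =
        ext_deriv \<epsilon> (\<lambda>w us. a I J w * wedge (map dz I @ map dzbar J) us) (T z) (map (frechet_derivative T (at z)) vs)"
      by (simp add: ext_deriv_scale [OF adiff] ext_deriv_const)
  qed
  also have "\<dots> = ext_deriv \<epsilon> (\<lambda>w us. \<Sum>I | length I = p. \<Sum>J | length J = q. a I J w * wedge (map dz I @ map dzbar J) us)
      (T z) (map (frechet_derivative T (at z)) vs)"
    using adiff by (simp add: ext_deriv_sum differentiable_sum differentiable_mult)
  also have "\<dots> = ext_deriv \<epsilon> \<eta> (T z) (map (frechet_derivative T (at z)) vs)"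
    by (intro ext_deriv_cong_open [OF S'(1) Tz]) (simp add: \<eta>_eq)
  finally show ?thesis .
qed

lemma local_pq_form_smooth:
  assumes "open S" "local_pq_form S p q \<omega>"
  shows "smooth_on S (\<lambda>z. \<omega> z us)"
proof -
  obtain a where a': "\<forall>I J. smooth_on S (a I J)"
    "\<forall>z\<in>S. \<forall>vs. \<omega> z vs = (\<Sum>I | length I = p. \<Sum>J | length J = q. a I J z * wedge (map dz I @ map dzbar J) vs)"
    using assms(2) by (rule local_pq_formE)
  note a = a'(1) [rule_format] and eq = a'(2) [rule_format]
  have "smooth_on S (\<lambda>z. \<Sum>I | length I = p. \<Sum>J | length J = q. wedge (map dz I @ map dzbar J) us * a I J z)"
    using assms(1) a by (intro smooth_on_sum smooth_on_cmult)
  then show ?thesis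
    by (rule smooth_on_cong [OF assms(1), rotated]) (simp add: eq mult.commute)
qed

lemma local_pq_form_cong:
  "\<lbrakk>\<And>z vs. z \<in> S \<Longrightarrow> \<omega> z vs = \<eta> z vs; local_pq_form S p q \<omega>\<rbrakk> \<Longrightarrow> local_pq_form S p q \<eta>"
  unfolding local_pq_form_def by simp

lemma local_pq_form_zero: "local_pq_form S p q (\<lambda>_ _. 0)"
  by (rule local_pq_formI [of _ "\<lambda>_ _ _. 0"]) (simp_all add: smooth_on_zero)

lemma local_pq_form_add:
  assumes "open S" "local_pq_form S p q \<omega>" "local_pq_form S p q \<eta>"
  shows "local_pq_form S p q (\<lambda>z vs. \<omega> z vs + \<eta> z vs)"
proof -
  obtain a where a': "\<forall>I J. smooth_on S (a I J)"
    "\<forall>z\<in>S. \<forall>vs. \<omega> z vs = (\<Sum>I | length I = p. \<Sum>J | length J = q. a I J z * wedge (map dz I @ map dzbar J) vs)"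
    using assms(2) by (rule local_pq_formE)
  note a = a' [rule_format]
  obtain b where b': "\<forall>I J. smooth_on S (b I J)"
    "\<forall>z\<in>S. \<forall>vs. \<eta> z vs = (\<Sum>I | length I = p. \<Sum>J | length J = q. b I J z * wedge (map dz I @ map dzbar J) vs)"
    using assms(3) by (rule local_pq_formE)
  note b = b' [rule_format]
  show ?thesis
  proof (rule local_pq_formI)
    show "smooth_on S (\<lambda>z. a I J z + b I J z)" for I J
      using assms(1) a(1) b(1) by (rule smooth_on_add)
  qed (simp add: a(2) b(2) distrib_right sum.distrib)
qed

lemma local_pq_form_scale:
  assumes "open S" "local_pq_form S p q \<omega>"
  shows "local_pq_form S p q (\<lambda>z vs. c * \<omega> z vs)"
proof -
  obtain a where a': "\<forall>I J. smooth_on S (a I J)"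
    "\<forall>z\<in>S. \<forall>vs. \<omega> z vs = (\<Sum>I | length I = p. \<Sum>J | length J = q. a I J z * wedge (map dz I @ map dzbar J) vs)"
    using assms(2) by (rule local_pq_formE)
  note a = a' [rule_format]
  show ?thesis
  proof (rule local_pq_formI)
    show "smooth_on S (\<lambda>z. c * a I J z)" for I J
      using assms(1) a(1) by (rule smooth_on_cmult)
  qed (simp add: a(2) sum_distrib_left mult.assoc)
qed

lemma sum_lists_Suc:
  "(\<Sum>K | length (K :: 'n::finite list) = Suc p. f K) = (\<Sum>k\<in>UNIV. \<Sum>I | length I = p. f (k # I))"
proof -
  have "{K :: 'n list. length K = Suc p} = (\<lambda>(k, I). k # I) ` (UNIV \<times> {I. length I = p})"
    by (auto simp: length_Suc_conv image_iff)
  then have "(\<Sum>K | length (K :: 'n list) = Suc p. f K) = (\<Sum>x\<in>UNIV \<times> {I. length I = p}. f ((\<lambda>(k, I). k # I) x))"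
    by (simp add: sum.reindex inj_on_def split_beta prod_eq_iff)
  then show ?thesis
    by (simp add: sum.cartesian_product split_beta)
qed

lemma wirtinger_coefficients:
  assumes S: "open S" "z \<in> S" and a: "\<And>I J. smooth_on S (a I J)"
    and eq: "\<And>z vs. z \<in> S \<Longrightarrow> \<omega> z vs = (\<Sum>I | length I = p. \<Sum>J | length J = q. a I J z * wedge (map dz I @ map dzbar J) vs)"
  shows "wirtinger \<epsilon> v (\<lambda>w. \<omega> w us) z =
    (\<Sum>I | length I = p. \<Sum>J | length J = q. wirtinger \<epsilon> v (a I J) z * wedge (map dz I @ map dzbar J) us)"
proof -
  have d: "a I J differentiable (at z)" for I J
    using a S(2) by (rule smooth_on_differentiable)
  have "wirtinger \<epsilon> v (\<lambda>w. \<omega> w us) z =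
      wirtinger \<epsilon> v (\<lambda>w. \<Sum>I | length I = p. \<Sum>J | length J = q. a I J w * wedge (map dz I @ map dzbar J) us) z"
    by (rule wirtinger_cong_open [OF S]) (rule eq)
  then show ?thesis
    using d by (simp add: wirtinger_sum wirtinger_mult wirtinger_const differentiable_sum differentiable_mult)
qed

text \<open>As multi-indices are arbitrary lists, \<open>dz k\<close> can be put in front of
  \<open>I\<close> without sorting: \<open>K\<close> encodes \<open>k # I\<close>, whence
  \<open>hd K\<close> and \<open>tl K\<close> in the coefficient.\<close>

lemma local_pq_form_del:
  assumes S: "open S" and \<omega>: "local_pq_form S p q \<omega>"
  shows "local_pq_form S (Suc p) q (local_del \<omega>)"
proof -
  obtain a where a': "\<forall>I J. smooth_on S (a I J)"
    "\<forall>z\<in>S. \<forall>vs. \<omega> z vs = (\<Sum>I | length I = p. \<Sum>J | length J = q. a I J z * wedge (map dz I @ map dzbar J) vs)"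
    using \<omega> by (rule local_pq_formE)
  note a = a'(1) [rule_format] and eq = a'(2) [rule_format]
  have "local_del \<omega> z vs = (\<Sum>K | length K = Suc p. \<Sum>J | length J = q.
      d_dz (hd K) (a (tl K) J) z * wedge (map dz K @ map dzbar J) vs)" if z: "z \<in> S" for z vs
  proof -
    have "d_dz k (\<lambda>w. \<omega> w us) z = (\<Sum>I | length I = p. \<Sum>J | length J = q.
        d_dz k (a I J) z * wedge (map dz I @ map dzbar J) us)" for k us
      unfolding d_dz_eq_wirtinger using S z a eq by (rule wirtinger_coefficients)
    then show ?thesis
      by (simp add: local_del_def sum_lists_Suc wedge1_sum wedge1_scale)
  qed
  moreover have "smooth_on S (d_dz (hd K) (a (tl K) J))" for K J
    using smooth_on_wirtinger [OF S a] by (simp add: d_dz_eq_wirtinger [abs_def])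
  ultimately show ?thesis
    by (rule local_pq_formI [rotated])
qed

text \<open>Here \<open>dzbar k\<close> has to pass the \<open>dz\<close> factors, and the sign
  \<open>(-1) ^ length I\<close> in the coefficient accounts for that.\<close>

lemma local_pq_form_delbar:
  assumes S: "open S" and \<omega>: "local_pq_form S p q \<omega>"
  shows "local_pq_form S p (Suc q) (local_delbar \<omega>)"
proof -
  obtain a where a': "\<forall>I J. smooth_on S (a I J)"
    "\<forall>z\<in>S. \<forall>vs. \<omega> z vs = (\<Sum>I | length I = p. \<Sum>J | length J = q. a I J z * wedge (map dz I @ map dzbar J) vs)"
    using \<omega> by (rule local_pq_formE)
  note a = a'(1) [rule_format] and eq = a'(2) [rule_format]
  have "local_delbar \<omega> z vs = (\<Sum>I | length I = p. \<Sum>K | length K = Suc q.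
      ((-1) ^ length I * d_dzbar (hd K) (a I (tl K)) z) * wedge (map dz I @ map dzbar K) vs)" if z: "z \<in> S" for z vs
  proof -
    have "d_dzbar k (\<lambda>w. \<omega> w us) z = (\<Sum>I | length I = p. \<Sum>J | length J = q.
        d_dzbar k (a I J) z * wedge (map dz I @ map dzbar J) us)" for k us
      unfolding d_dzbar_eq_wirtinger using S z a eq by (rule wirtinger_coefficients)
    then have "local_delbar \<omega> z vs = (\<Sum>k\<in>UNIV. \<Sum>I | length I = p. \<Sum>J | length J = q.
        d_dzbar k (a I J) z * wedge (dzbar k # map dz I @ map dzbar J) vs)"
      by (simp add: local_delbar_def wedge1_sum wedge1_scale)
    also have "\<dots> = (\<Sum>I | length I = p. \<Sum>k\<in>UNIV. \<Sum>J | length J = q.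
        d_dzbar k (a I J) z * wedge (dzbar k # map dz I @ map dzbar J) vs)"
      by (rule sum.swap)
    finally show ?thesis
      by (simp add: sum_lists_Suc wedge_move mult_ac del: wedge.simps)
  qed
  moreover have "smooth_on S (\<lambda>z. (-1) ^ length I * d_dzbar (hd K) (a I (tl K)) z)" for I K
    using smooth_on_cmult [OF S smooth_on_wirtinger [OF S a]] by (simp add: d_dzbar_eq_wirtinger)
  ultimately show ?thesis
    by (rule local_pq_formI [rotated])
qed

section \<open>Forms on a complex manifold\<close>

text \<open>For \<open>\<epsilon> = -\<i>\<close> this agrees on forms with \<^const>\<open>del\<close>, for \<open>\<epsilon> = \<i>\<close> with \<^const>\<open>delbar\<close>.\<close>

definition mform_deriv :: "complex \<Rightarrow> ('a, 'n::finite) chart set \<Rightarrow> ('a, 'n) mform \<Rightarrow> ('a, 'n) mform" where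
  "mform_deriv \<epsilon> \<A> \<omega> c z vs = (if c \<in> \<A> \<and> z \<in> chart_image c then ext_deriv \<epsilon> (\<omega> c) z vs else 0)"

lemma zero_in_pq_forms: "(\<lambda>_ _ _. 0) \<in> pq_forms \<A> p q"
  by (simp add: pq_forms_def local_pq_form_zero)

lemma mform_deriv_zero: "mform_deriv \<epsilon> \<A> (\<lambda>_ _ _. 0) = (\<lambda>_ _ _. 0)"
  by (intro ext) (simp add: mform_deriv_def ext_deriv_const)

context
  fixes X :: "'a topology" and \<A> :: "('a, 'n::finite) chart set"
  assumes M: "complex_manifold X \<A>"
begin

lemma open_chart_image: "c \<in> \<A> \<Longrightarrow> open (chart_image c)"
  using M by (simp add: complex_manifold_def)

lemma inj_on_chart:
  assumes "c \<in> \<A>"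
  shows "inj_on (snd c) (fst c)"
proof -
  have "openin X (fst c)" "homeomorphic_map (subtopology X (fst c)) (top_of_set (chart_image c)) (snd c)"
    using M assms by (auto simp: complex_manifold_def)
  then show ?thesis
    using homeomorphic_imp_injective_map [of "subtopology X (fst c)"] openin_subset [of X "fst c"]
    by (simp add: topspace_subtopology inf_absorb2)
qed

lemma open_transition_domain:
  assumes "c \<in> \<A>" "c' \<in> \<A>"
  shows "open (transition_domain c c')"
proof -
  have h: "openin X (fst c)" "openin X (fst c')" "homeomorphic_map (subtopology X (fst c)) (top_of_set (chart_image c)) (snd c)"
    using M assms by (auto simp: complex_manifold_def)
  have "openin (subtopology X (fst c)) (fst c \<inter> fst c')"
    using h by (metis openin_subtopology_Int inf_commute)
  then have "openin (top_of_set (chart_image c)) (snd c ` (fst c \<inter> fst c'))"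
    using homeomorphic_imp_open_map [OF h(3)] by (simp add: open_map_def)
  then show ?thesis
    using openin_open_trans open_chart_image [OF assms(1)] by (auto simp: transition_domain_def)
qed

lemma transition_domain_subset: "transition_domain c c' \<subseteq> chart_image c"
  by (auto simp: transition_domain_def chart_image_def)

lemma transition_in_chart_image:
  assumes "c \<in> \<A>" "z \<in> transition_domain c c'"
  shows "transition c c' z \<in> chart_image c'"
  using assms inv_into_f_f [OF inj_on_chart [OF assms(1)]]
  by (auto simp: transition_domain_def transition_def chart_image_def)

lemma holomorphic_transition:
  "\<lbrakk>c \<in> \<A>; c' \<in> \<A>\<rbrakk> \<Longrightarrow> holomorphic_map_on (transition_domain c c') (transition c c')"
  using M by (simp add: complex_manifold_def)

lemma pq_forms_smooth:
  assumes "\<omega> \<in> pq_forms \<A> p q" "c \<in> \<A>"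
  shows "smooth_on (chart_image c) (\<lambda>z. \<omega> c z us)"
proof (cases "p < 0 \<or> q < 0")
  case True
  then show ?thesis
    using assms by (simp add: pq_forms_def smooth_on_zero)
next
  case False
  then have "local_pq_form (chart_image c) (nat p) (nat q) (\<omega> c)"
    using assms by (simp add: pq_forms_def)
  then show ?thesis
    by (rule local_pq_form_smooth [OF open_chart_image [OF assms(2)]])
qed

lemma pq_forms_differentiable:
  "\<lbrakk>\<omega> \<in> pq_forms \<A> p q; c \<in> \<A>; z \<in> chart_image c\<rbrakk> \<Longrightarrow> (\<lambda>z. \<omega> c z us) differentiable (at z)"
  using pq_forms_smooth smooth_on_differentiable by blast

lemma del_eq_mform_deriv:
  assumes "\<omega> \<in> pq_forms \<A> p q"
  shows "del \<A> \<omega> = mform_deriv (- \<i>) \<A> \<omega>"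
  by (intro ext) (simp add: del_def mform_deriv_def local_del_eq_ext_deriv pq_forms_differentiable [OF assms])

lemma delbar_eq_mform_deriv:
  assumes "\<omega> \<in> pq_forms \<A> p q"
  shows "delbar \<A> \<omega> = mform_deriv \<i> \<A> \<omega>"
  by (intro ext) (simp add: delbar_def mform_deriv_def local_delbar_eq_ext_deriv pq_forms_differentiable [OF assms])

lemma mform_deriv_pullback:
  assumes \<omega>: "\<omega> \<in> pq_forms \<A> p q" and c: "c \<in> \<A>" "c' \<in> \<A>" and z: "z \<in> transition_domain c c'"
    and pq: "\<not> (p < 0 \<or> q < 0)"
  shows "mform_deriv \<epsilon> \<A> \<omega> c z vs =
    mform_deriv \<epsilon> \<A> \<omega> c' (transition c c' z) (map (frechet_derivative (transition c c') (at z)) vs)"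
proof -
  have "ext_deriv \<epsilon> (\<omega> c) z vs =
      ext_deriv \<epsilon> (\<omega> c') (transition c c' z) (map (frechet_derivative (transition c c') (at z)) vs)"
  proof (rule ext_deriv_pullback [OF open_transition_domain [OF c] z holomorphic_transition [OF c] open_chart_image [OF c(2)]])
    show "transition c c' ` transition_domain c c' \<subseteq> chart_image c'"
      using transition_in_chart_image [OF c(1)] by blast
    show "local_pq_form (chart_image c') (nat p) (nat q) (\<omega> c')"
      using \<omega> c pq by (simp add: pq_forms_def)
    show "\<omega> c w us = \<omega> c' (transition c c' w) (map (frechet_derivative (transition c c') (at w)) us)"
      if "w \<in> transition_domain c c'" for w us
      using \<omega> c pq that unfolding pq_forms_def if_not_P [OF pq] mem_Collect_eq by (elim conjE) blast
  qed
  moreover have "z \<in> chart_image c" "transition c c' z \<in> chart_image c'"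
    by (rule subsetD [OF transition_domain_subset z], rule transition_in_chart_image [OF c(1) z])
  ultimately show ?thesis
    using c by (simp add: mform_deriv_def)
qed

lemma del_closed:
  assumes \<omega>: "\<omega> \<in> pq_forms \<A> p q"
  shows "del \<A> \<omega> \<in> pq_forms \<A> (p + 1) q"
proof (cases "p < 0 \<or> q < 0")
  \<comment> \<open>The target bidegree can be nonnegative, as for \<open>p = -1\<close>, but the
    only form in the source is zero.\<close>
  case True
  then have \<omega>0: "\<omega> = (\<lambda>_ _ _. 0)"
    using \<omega> by (simp add: pq_forms_def)
  have "del \<A> \<omega> = (\<lambda>_ _ _. 0)"
    unfolding del_eq_mform_deriv [OF \<omega>] unfolding \<omega>0 by (rule mform_deriv_zero)
  then show ?thesis
    by (simp add: zero_in_pq_forms)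
next
  case False
  have "local_pq_form (chart_image c) (nat (p + 1)) (nat q) (del \<A> \<omega> c)" if c: "c \<in> \<A>" for c
  proof (rule local_pq_form_cong)
    have "nat (p + 1) = Suc (nat p)"
      using False by (auto simp: nat_add_distrib)
    then show "local_pq_form (chart_image c) (nat (p + 1)) (nat q) (local_del (\<omega> c))"
      using \<omega> c False local_pq_form_del [OF open_chart_image [OF c]] by (simp add: pq_forms_def)
  qed (simp add: del_def c)
  then show ?thesis
    using False mform_deriv_pullback [OF \<omega> _ _ _ False, of _ _ _ "- \<i>"] unfolding pq_forms_def
    by (simp add: del_eq_mform_deriv [OF \<omega>]) (auto simp: mform_deriv_def)
qed

lemma delbar_closed:
  assumes \<omega>: "\<omega> \<in> pq_forms \<A> p q"
  shows "delbar \<A> \<omega> \<in> pq_forms \<A> p (q + 1)"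
proof (cases "p < 0 \<or> q < 0")
  case True
  then have \<omega>0: "\<omega> = (\<lambda>_ _ _. 0)"
    using \<omega> by (simp add: pq_forms_def)
  have "delbar \<A> \<omega> = (\<lambda>_ _ _. 0)"
    unfolding delbar_eq_mform_deriv [OF \<omega>] unfolding \<omega>0 by (rule mform_deriv_zero)
  then show ?thesis
    by (simp add: zero_in_pq_forms)
next
  case False
  have "local_pq_form (chart_image c) (nat p) (nat (q + 1)) (delbar \<A> \<omega> c)" if c: "c \<in> \<A>" for c
  proof (rule local_pq_form_cong)
    have "nat (q + 1) = Suc (nat q)"
      using False by (auto simp: nat_add_distrib)
    then show "local_pq_form (chart_image c) (nat p) (nat (q + 1)) (local_delbar (\<omega> c))"
      using \<omega> c False local_pq_form_delbar [OF open_chart_image [OF c]] by (simp add: pq_forms_def)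
  qed (simp add: delbar_def c)
  then show ?thesis
    using False mform_deriv_pullback [OF \<omega> _ _ _ False, of _ _ _ \<i>] unfolding pq_forms_def
    by (simp add: delbar_eq_mform_deriv [OF \<omega>]) (auto simp: mform_deriv_def)
qed

lemma mform_deriv_anticommute:
  assumes \<omega>: "\<omega> \<in> pq_forms \<A> p q"
  shows "mform_deriv \<epsilon> \<A> (mform_deriv \<delta> \<A> \<omega>) c z vs = - mform_deriv \<delta> \<A> (mform_deriv \<epsilon> \<A> \<omega>) c z vs"
proof (cases "c \<in> \<A> \<and> z \<in> chart_image c")
  case True
  then have S: "open (chart_image c)" "z \<in> chart_image c"
    using open_chart_image by auto
  \<comment> \<open>The inner derivative agrees with \<open>ext_deriv\<close> on the whole open
    chart image, so the cut-off to zero outside does not affect the outer one.\<close>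
  have eq: "mform_deriv \<epsilon> \<A> (mform_deriv \<delta> \<A> \<omega>) c z vs = ext_deriv \<epsilon> (ext_deriv \<delta> (\<omega> c)) z vs" for \<epsilon> \<delta>
    using True by (simp add: mform_deriv_def) (rule ext_deriv_cong_open [OF S], simp add: mform_deriv_def)
  show ?thesis
    unfolding eq by (rule ext_deriv_anticommute [OF S pq_forms_smooth [OF \<omega> conjunct1 [OF True]]])
qed (auto simp: mform_deriv_def)

lemma pq_forms_add:
  assumes "\<omega> \<in> pq_forms \<A> p q" "\<eta> \<in> pq_forms \<A> p q"
  shows "(\<lambda>c z vs. \<omega> c z vs + \<eta> c z vs) \<in> pq_forms \<A> p q"
proof (cases "p < 0 \<or> q < 0")
  case False
  then show ?thesis
    using assms local_pq_form_add [OF open_chart_image] by (simp add: pq_forms_def)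
qed (use assms in \<open>simp add: pq_forms_def\<close>)

lemma pq_forms_scale:
  assumes "\<omega> \<in> pq_forms \<A> p q"
  shows "(\<lambda>c z vs. a * \<omega> c z vs) \<in> pq_forms \<A> p q"
proof (cases "p < 0 \<or> q < 0")
  case False
  then show ?thesis
    using assms local_pq_form_scale [OF open_chart_image] by (simp add: pq_forms_def)
qed (use assms in \<open>simp add: pq_forms_def\<close>)

lemma mform_deriv_add:
  assumes "\<omega> \<in> pq_forms \<A> p q" "\<eta> \<in> pq_forms \<A> p q"
  shows "mform_deriv \<epsilon> \<A> (\<lambda>c z vs. \<omega> c z vs + \<eta> c z vs) =
    (\<lambda>c z vs. mform_deriv \<epsilon> \<A> \<omega> c z vs + mform_deriv \<epsilon> \<A> \<eta> c z vs)"
  by (intro ext) (simp add: mform_deriv_def ext_deriv_add pq_forms_differentiable [OF assms(1)]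
      pq_forms_differentiable [OF assms(2)])

lemma mform_deriv_scale:
  assumes "\<omega> \<in> pq_forms \<A> p q"
  shows "mform_deriv \<epsilon> \<A> (\<lambda>c z vs. a * \<omega> c z vs) = (\<lambda>c z vs. a * mform_deriv \<epsilon> \<A> \<omega> c z vs)"
  by (intro ext) (simp add: mform_deriv_def ext_deriv_cmult pq_forms_differentiable [OF assms])

end

section \<open>The double complex of forms and the two dimensions\<close>

text \<open>The ambient space that \<open>double_complex\<close> asks for. It does not depend on the
  bidegree, so images coming from different bidegrees can be added and intersected inside
  it.\<close>

definition mform_module :: "(complex, ('a, 'n::finite) mform) module" where
  "mform_module = \<lparr>carrier = UNIV, mult = undefined, one = undefined,
     zero = (\<lambda>_ _ _. 0), add = (\<lambda>\<omega> \<eta> c z vs. \<omega> c z vs + \<eta> c z vs),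
     smult = (\<lambda>a \<omega> c z vs. a * \<omega> c z vs)\<rparr>"

lemma form_space_eq: "form_space \<A> p q = mform_module\<lparr>carrier := pq_forms \<A> p q\<rparr>"
  by (simp add: form_space_def mform_module_def)

lemma field_complex_field: "field complex_field"
proof -
  have "cring complex_field"
    by (intro cringI abelian_groupI comm_monoidI)
      (auto simp: complex_field_def algebra_simps intro: exI [of _ "- _"] add.left_inverse)
  moreover have "Units complex_field = UNIV - {0}"
    by (auto simp: complex_field_def Units_def intro: exI [of _ "inverse _"] left_inverse right_inverse)
  ultimately show ?thesis
    by (intro cring.cring_fieldI) (simp_all add: complex_field_def)
qed

lemma vectorspace_mform_module:
  "vectorspace complex_field (mform_module :: (complex, ('a, 'n::finite) mform) module)"
proof -
  have "abelian_group (mform_module :: (complex, ('a, 'n) mform) module)"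
  proof (rule abelian_groupI)
    show "\<exists>y\<in>carrier mform_module. y \<oplus>\<^bsub>mform_module\<^esub> x = \<zero>\<^bsub>mform_module\<^esub>" for x :: "('a, 'n) mform"
      by (rule bexI [of _ "\<lambda>c z vs. - x c z vs"]) (simp_all add: mform_module_def)
  qed (simp_all add: mform_module_def fun_eq_iff)
  moreover have "cring complex_field"
    using field_complex_field by (simp add: field_def domain_def)
  ultimately have "Module.module complex_field (mform_module :: (complex, ('a, 'n) mform) module)"
    by (intro moduleI) (simp_all add: mform_module_def complex_field_def fun_eq_iff algebra_simps)
  then show ?thesis
    using field_complex_field by (simp add: vectorspace_def)
qed

lemma uminus_mform_module: "\<ominus>\<^bsub>mform_module\<^esub> \<omega> = (\<lambda>c z vs. - \<omega> c z vs)"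
proof -
  interpret V: vectorspace complex_field mform_module
    by (rule vectorspace_mform_module)
  show ?thesis
    by (rule V.module.M.minus_equality) (simp_all add: mform_module_def)
qed

lemma double_complex_forms:
  fixes \<A> :: "('a, 'n::finite) chart set"
  assumes M: "complex_manifold X \<A>"
  shows "double_complex complex_field mform_module (pq_forms \<A>) (del \<A>) (delbar \<A>)"
proof (rule double_complex.intro)
  note add = pq_forms_add [OF M] and scale = pq_forms_scale [OF M]
  note d = del_eq_mform_deriv [OF M] and d' = delbar_eq_mform_deriv [OF M]
  note cl = del_closed [OF M] and cl' = delbar_closed [OF M]
  note md = mform_deriv_add [OF M] mform_deriv_scale [OF M]
  note anti = mform_deriv_anticommute [OF M]
  fix p q
  show "vectorspace complex_field (mform_module :: (complex, ('a, 'n) mform) module)"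
    by (rule vectorspace_mform_module)
  then show "submodule complex_field (pq_forms \<A> p q) mform_module"
    using add scale zero_in_pq_forms [of \<A> p q]
    by (intro submodule.intro) (simp_all add: vectorspace_def mform_module_def)
  show "del \<A> \<in> module_hom complex_field (mform_module\<lparr>carrier := pq_forms \<A> p q\<rparr>) mform_module"
  proof -
    have "del \<A> (\<lambda>c z vs. \<omega> c z vs + \<eta> c z vs) = (\<lambda>c z vs. del \<A> \<omega> c z vs + del \<A> \<eta> c z vs)"
      if "\<omega> \<in> pq_forms \<A> p q" "\<eta> \<in> pq_forms \<A> p q" for \<omega> \<eta>
      unfolding d [OF add [OF that]] d [OF that(1)] d [OF that(2)] by (rule md(1) [OF that])
    moreover have "del \<A> (\<lambda>c z vs. a * \<omega> c z vs) = (\<lambda>c z vs. a * del \<A> \<omega> c z vs)"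
      if "\<omega> \<in> pq_forms \<A> p q" for a \<omega>
      unfolding d [OF scale [OF that]] d [OF that] by (rule md(2) [OF that])
    ultimately show ?thesis
      by (simp add: module_hom_def mform_module_def)
  qed
  show "delbar \<A> \<in> module_hom complex_field (mform_module\<lparr>carrier := pq_forms \<A> p q\<rparr>) mform_module"
  proof -
    have "delbar \<A> (\<lambda>c z vs. \<omega> c z vs + \<eta> c z vs) = (\<lambda>c z vs. delbar \<A> \<omega> c z vs + delbar \<A> \<eta> c z vs)"
      if "\<omega> \<in> pq_forms \<A> p q" "\<eta> \<in> pq_forms \<A> p q" for \<omega> \<eta>
      unfolding d' [OF add [OF that]] d' [OF that(1)] d' [OF that(2)] by (rule md(1) [OF that])
    moreover have "delbar \<A> (\<lambda>c z vs. a * \<omega> c z vs) = (\<lambda>c z vs. a * delbar \<A> \<omega> c z vs)"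
      if "\<omega> \<in> pq_forms \<A> p q" for a \<omega>
      unfolding d' [OF scale [OF that]] d' [OF that] by (rule md(2) [OF that])
    ultimately show ?thesis
      by (simp add: module_hom_def mform_module_def)
  qed
  fix x assume x: "x \<in> pq_forms \<A> p q"
  show "del \<A> x \<in> pq_forms \<A> (p + 1) q" "delbar \<A> x \<in> pq_forms \<A> p (q + 1)"
    using x by (rule cl, rule cl')
  note D = d [OF x] d' [OF x] d [OF cl [OF x]] d' [OF cl' [OF x]] d [OF cl' [OF x]] d' [OF cl [OF x]]
  \<comment> \<open>Anticommutation with equal parameters makes the form its own negative.\<close>
  have self: "mform_deriv \<epsilon> \<A> (mform_deriv \<epsilon> \<A> x) = (\<lambda>_ _ _. 0)" for \<epsilon>
    using anti [OF x, of \<epsilon> \<epsilon>] by (simp add: fun_eq_iff)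
  have zero: "\<zero>\<^bsub>mform_module\<^esub> = (\<lambda>_ _ _. 0 :: complex)"
    by (simp add: mform_module_def)
  show "del \<A> (del \<A> x) = \<zero>\<^bsub>mform_module\<^esub>"
    unfolding D(3) unfolding D(1) self zero ..
  show "delbar \<A> (delbar \<A> x) = \<zero>\<^bsub>mform_module\<^esub>"
    unfolding D(4) unfolding D(2) self zero ..
  show "del \<A> (delbar \<A> x) = \<ominus>\<^bsub>mform_module\<^esub> delbar \<A> (del \<A> x)"
    unfolding D(5,6) unfolding D(1,2) uminus_mform_module by (intro ext anti [OF x])
qed

text \<open>\<open>a_kernel\<close> compares with the zero of \<open>H_delbar\<close>, which is the
  subspace \<open>im_delbar\<close> in bidegree \<open>(p + 1, q)\<close>. The instantiated
  \<open>quotient_module_def\<close> exposes this zero and leaves the other quotients folded, as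
  \<open>dim_G\<close> states them.\<close>

lemma g_del_eq_dim:
  assumes "complex_manifold X \<A>"
  shows "g_del \<A> p q = vectorspace.dim complex_field (quotient_module
    (mform_module\<lparr>carrier := del \<A> ` pq_forms \<A> p q \<inter> delbar \<A> ` pq_forms \<A> (p + 1) (q - 1)\<rparr>)
    ((\<lambda>x. del \<A> (delbar \<A> x)) ` pq_forms \<A> p (q - 1)))"
proof -
  interpret double_complex complex_field mform_module "pq_forms \<A>" "del \<A>" "delbar \<A>"
    by (rule double_complex_forms [OF assms])
  have zero: "\<zero>\<^bsub>mform_module\<^esub> = (\<lambda>_ _ _. 0 :: complex)"
    by (simp add: mform_module_def)
  show ?thesis
    unfolding dim_G [symmetric]
    by (simp add: g_del_def G_del_def calG_del_def a_kernel_def' H_A_def H_del_def H_delbar_def pi_A_def del_A_def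
        im_A_def im_del_def im_delbar_def form_space_eq zero quotient_module_def [of _ "delbar \<A> ` pq_forms \<A> (p + 1) (q - 1)"])
qed

lemma g_delbar_eq_dim:
  assumes "complex_manifold X \<A>"
  shows "g_delbar \<A> p q = vectorspace.dim complex_field (quotient_module
    (mform_module\<lparr>carrier := delbar \<A> ` pq_forms \<A> p q \<inter> del \<A> ` pq_forms \<A> (p - 1) (q + 1)\<rparr>)
    ((\<lambda>x. delbar \<A> (del \<A> x)) ` pq_forms \<A> (p - 1) q))"
proof -
  interpret double_complex complex_field mform_module "pq_forms \<A>" "del \<A>" "delbar \<A>"
    by (rule double_complex_forms [OF assms])
  have zero: "\<zero>\<^bsub>mform_module\<^esub> = (\<lambda>_ _ _. 0 :: complex)"
    by (simp add: mform_module_def)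
  \<comment> \<open>\<open>H_A\<close> is defined with \<partial>\<partial>bar, while the transposed
    complex yields the cocycles of \<partial>bar\<partial>.\<close>
  have Z: "{\<theta> \<in> pq_forms \<A> p q. del \<A> (delbar \<A> \<theta>) = (\<lambda>_ _ _. 0)} = {\<theta> \<in> pq_forms \<A> p q. delbar \<A> (del \<A> \<theta>) = (\<lambda>_ _ _. 0)}"
    using anti_zero_iff unfolding zero by blast
  show ?thesis
    unfolding double_complex.dim_G [OF swap, symmetric]
    by (simp add: g_delbar_def G_delbar_def calG_delbar_def a_kernel_def' H_A_def H_del_def H_delbar_def pi_A_def delbar_A_def
        im_A_def im_del_def im_delbar_def form_space_eq zero Z im_sum_commute
        quotient_module_def [of _ "del \<A> ` pq_forms \<A> (p - 1) (q + 1)"])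
qed

text \<open>In bidegree \<open>(p + 1, q - 1)\<close> the formula for \<open>g_delbar\<close>
  intersects the image of \<partial>bar from \<open>(p + 1, q - 1)\<close> with that of \<partial>
  from \<open>(p, q)\<close> and divides by the image of \<partial>bar\<partial> from
  \<open>(p, q - 1)\<close>. Up to the order of the two operators this is the quotient found for
  \<open>g_del\<close>.\<close>

theorem proposition5p1:
  fixes X :: "'a topology"
    and \<A> :: "('a, 'n::finite) chart set"
    and p q :: int
  assumes "complex_manifold X \<A>"
    and "compact_space X"
  shows "g_del \<A> p q = g_delbar \<A> (p + 1) (q - 1)"
  unfolding g_del_eq_dim [OF assms(1)] g_delbar_eq_dim [OF assms(1)]
    double_complex.image_anticommute [OF double_complex_forms [OF assms(1)]]
  by (simp add: Int_commute)

end
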